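(* Let $n\in\mathbb{N}$, let $\Omega\subset\mathbb{R}^n$ be open, $p\in(1,+\infty)$, $s\in\left(0,\frac1p\right)$, $m\in[p,+\infty)$, and let $W$ be a potential satisfying the standing assumptions listed in the context and such that, for some $c_2,c_3\in(0,+\infty)$, $$c_3(1-x^2)^m\ge W(x)\ge c_2(1-x^2)^m\qquad\text{for every }x\in(-1,1).$$ For $\epsilon\to0^+$, let $\{u_\epsilon\}_\epsilon\subset X^{s,p}(\Omega)$ be such that $u_\epsilon$ is a minimizer of $\mathcal{F}_{s,\epsilon}^p$ in $\Omega$, $\sup_\epsilon\mathcal{F}_{s,\epsilon}^p(u_\epsilon,\Omega)<+\infty$, and let $E\subset\mathbb{R}^n$ be a measurable set such that $u_\epsilon\to\chi_E-\chi_{E^c}$ in $L^1_{\mathrm{loc}}(\Omega)$ as $\epsilon\to0^+$ ($\epsilon$ ranging in the given sequence). Then, for every $\Theta\in(0,1)$, $\delta\in(0,+\infty)$ and $R\in(0,+\infty)$ satisfying $B_R\Subset\Omega$, there exists $\epsilon_0=\epsilon_0(\Theta,\delta,R)>0$ such that, if $\epsilon\in(0,\epsilon_0)$ (in the given sequence), $$\{|u_\epsilon|<\Theta\}\cap B_R\subset\bigcup_{x\in\partial E}B_\delta(x).$$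
   Context: Standing assumptions on $W$: $W\in C^1([-1,1],[0,+\infty))$ and, for some $\theta\in(-1,1)$, $\lambda\in(0,1]$, $\Lambda\in[1,+\infty)$, $\lambda\chi_{(-\infty,\theta]}(x)|1+x|^m\le W(x)\le\Lambda|1+x|^m$ for every $x\in[-1,1]$; moreover, for some $q\in(0,\theta+1]\cap(0,1)$ and $c_1\in(0,+\infty)$, $c_1|1+x|^{m-1}\le W'(x)$ for every $x\in(-1,-1+q)$. Here $\chi_A$ is the characteristic function of $A$, $B_\delta(x)$ is the ball of radius $\delta$ centered at $x$ and $B_R:=B_R(0)$. For measurable $u:\mathbb{R}^n\to\mathbb{R}$, $$\mathcal{K}_s^p(u,\Omega):=\frac12\int_\Omega\int_\Omega\frac{|u(x)-u(y)|^p}{|x-y|^{n+sp}}\,dx\,dy+\int_\Omega\int_{\mathbb{R}^n\setminus\Omega}\frac{|u(x)-u(y)|^p}{|x-y|^{n+sp}}\,dx\,dy,$$ and, for $\epsilon\in(0,1)$, $$\mathcal{F}_{s,\epsilon}^p(u,\Omega):=\mathcal{K}_s^p(u,\Omega)+\epsilon^{-sp}\int_\Omega W(u(x))\,dx.$$ Set $X^{s,p}(\Omega):=\{u:\mathbb{R}^n\to\mathbb{R}\text{ measurable s.t. }\mathcal{K}_s^p(u,\Omega)<+\infty\text{ and }\|u\|_{L^\infty(\mathbb{R}^n)}\le1\}$. If $\Omega$ is bounded, $u\in X^{s,p}(\Omega)$ is a minimizer of $\mathcal{F}_{s,\epsilon}^p$ in $\Omega$ if $\mathcal{F}_{s,\epsilon}^p(u,\Omega)\le\mathcal{F}_{s,\epsilon}^p(v,\Omega)$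 for any $v\in X^{s,p}(\Omega)$ with $v\equiv u$ in $\mathbb{R}^n\setminus\Omega$. If $\Omega$ is unbounded, $u\in X^{s,p}(\Omega)$ is a minimizer in $\Omega$ if it is a minimizer in every bounded open set $\Omega'\Subset\Omega$. Minimizers are locally Hölder continuous in $\Omega$ (after modification on a null set), and $u_\epsilon$ is identified with its continuous representative in $\Omega$. *)

theory Defs
  imports "HOL-Analysis.Analysis" "HOL-Probability.Essential_Supremum"
begin

text \<open>
  Throughout, ``measurable'' means Lebesgue measurable, and energies take values in
  \<^typ>\<open>ennreal\<close>, so that they are defined for every measurable function.
\<close>

text \<open>
  On the diagonal the quotient below evaluates to \<open>0\<close>; the diagonal is a null set.
\<close>

definition gagliardo_kernel ::
  "real \<Rightarrow> real \<Rightarrow> (real ^ 'n \<Rightarrow> real) \<Rightarrow> real ^ 'n \<Rightarrow> real ^ 'n \<Rightarrow> real" where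
  "gagliardo_kernel s p u x y =
     \<bar>u x - u y\<bar> powr p / norm (x - y) powr (real CARD('n) + s * p)"

definition kinetic_energy ::
  "real \<Rightarrow> real \<Rightarrow> (real ^ 'n \<Rightarrow> real) \<Rightarrow> (real ^ 'n) set \<Rightarrow> ennreal" where
  "kinetic_energy s p u \<Omega> =
     ennreal (1 / 2) *
       (\<integral>\<^sup>+y\<in>\<Omega>. (\<integral>\<^sup>+x\<in>\<Omega>. ennreal (gagliardo_kernel s p u x y) \<partial>lebesgue) \<partial>lebesgue)
     + (\<integral>\<^sup>+y\<in>\<Omega>. (\<integral>\<^sup>+x\<in>- \<Omega>. ennreal (gagliardo_kernel s p u x y) \<partial>lebesgue) \<partial>lebesgue)"

definition total_energy ::
  "real \<Rightarrow> real \<Rightarrow> (real \<Rightarrow> real) \<Rightarrow> real \<Rightarrow> (real ^ 'n \<Rightarrow> real) \<Rightarrow> (real ^ 'n) set \<Rightarrow> ennreal" where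
  "total_energy s p W \<epsilon> u \<Omega> =
     kinetic_energy s p u \<Omega>
     + ennreal (\<epsilon> powr (- (s * p))) * (\<integral>\<^sup>+x\<in>\<Omega>. ennreal (W (u x)) \<partial>lebesgue)"

definition Xsp :: "real \<Rightarrow> real \<Rightarrow> (real ^ 'n) set \<Rightarrow> (real ^ 'n \<Rightarrow> real) set" where
  "Xsp s p \<Omega> =
     {u. u \<in> borel_measurable lebesgue \<and> kinetic_energy s p u \<Omega> < \<infinity> \<and>
         esssup lebesgue (\<lambda>x. ereal \<bar>u x\<bar>) \<le> 1}"

definition compactly_contained :: "'a::topological_space set \<Rightarrow> 'a set \<Rightarrow> bool" where
  "compactly_contained A B \<longleftrightarrow> compact (closure A) \<and> closure A \<subseteq> B"

definition minimizer_bounded ::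
  "real \<Rightarrow> real \<Rightarrow> (real \<Rightarrow> real) \<Rightarrow> real \<Rightarrow> (real ^ 'n) set \<Rightarrow> (real ^ 'n \<Rightarrow> real) \<Rightarrow> bool" where
  "minimizer_bounded s p W \<epsilon> \<Omega> u \<longleftrightarrow>
     u \<in> Xsp s p \<Omega> \<and>
     (\<forall>v \<in> Xsp s p \<Omega>. (\<forall>x. x \<notin> \<Omega> \<longrightarrow> v x = u x) \<longrightarrow>
        total_energy s p W \<epsilon> u \<Omega> \<le> total_energy s p W \<epsilon> v \<Omega>)"

definition minimizer ::
  "real \<Rightarrow> real \<Rightarrow> (real \<Rightarrow> real) \<Rightarrow> real \<Rightarrow> (real ^ 'n) set \<Rightarrow> (real ^ 'n \<Rightarrow> real) \<Rightarrow> bool" where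
  "minimizer s p W \<epsilon> \<Omega> u \<longleftrightarrow>
     (if bounded \<Omega> then minimizer_bounded s p W \<epsilon> \<Omega> u
      else u \<in> Xsp s p \<Omega> \<and>
        (\<forall>\<Omega>'. open \<Omega>' \<and> bounded \<Omega>' \<and> compactly_contained \<Omega>' \<Omega> \<longrightarrow>
           minimizer_bounded s p W \<epsilon> \<Omega>' u))"

text \<open>
  The potential only matters on \<open>[-1,1]\<close>, and its derivative \<open>W'\<close> is taken within \<open>[-1,1]\<close>,
  hence one-sided at the endpoints.
\<close>

definition standing_potential :: "real \<Rightarrow> (real \<Rightarrow> real) \<Rightarrow> bool" where
  "standing_potential m W \<longleftrightarrow>
     (\<forall>x\<in>{-1..1}. 0 \<le> W x) \<and>
     (\<exists>W'. continuous_on {-1..1} W' \<and>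
        (\<forall>x\<in>{-1..1}. (W has_real_derivative W' x) (at x within {-1..1})) \<and>
        (\<exists>\<theta> lam Lam q c1.
           \<theta> \<in> {-1<..<1} \<and> lam \<in> {0<..1} \<and> Lam \<ge> 1 \<and>
           q \<in> {0<..\<theta> + 1} \<inter> {0<..<1} \<and> c1 > 0 \<and>
           (\<forall>x\<in>{-1..1}. lam * indicator {..\<theta>} x * \<bar>1 + x\<bar> powr m \<le> W x \<and>
                          W x \<le> Lam * \<bar>1 + x\<bar> powr m) \<and>
           (\<forall>x\<in>{-1<..<-1 + q}. c1 * \<bar>1 + x\<bar> powr (m - 1) \<le> W' x)))"

definition L1_loc_tendsto ::
  "(real ^ 'n) set \<Rightarrow> (nat \<Rightarrow> real ^ 'n \<Rightarrow> real) \<Rightarrow> (real ^ 'n \<Rightarrow> real) \<Rightarrow> bool" where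
  "L1_loc_tendsto \<Omega> f g \<longleftrightarrow>
     (\<forall>C. compact C \<and> C \<subseteq> \<Omega> \<longrightarrow>
        (\<lambda>k. \<integral>\<^sup>+x\<in>C. ennreal \<bar>f k x - g x\<bar> \<partial>lebesgue) \<longlonglongrightarrow> 0)"

end

theory Submission
  imports Defs
begin

text \<open>
  Write \<open>\<sigma> = sp < 1\<close>, \<open>\<beta> = \<sigma>/n\<close> and \<open>v = 1 + u\<close>. Near a point at distance at least \<open>\<delta>\<close> from the boundary of \<open>E\<close> the
  functions \<open>u\<^sub>\<epsilon>\<close> converge to \<open>-1\<close> (or to \<open>1\<close>, which is the same case for \<open>-u\<close> and \<open>W(-x)\<close>), and it
  suffices that smallness of \<open>|{v > 1/2} \<inter> B\<^sub>r|\<close> and of \<open>\<epsilon>\<close> forces \<open>v \<le> 2a\<close> on \<open>B\<^bsub>r/4\<^esub>\<close>.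
  Because \<open>\<sigma> < 1\<close>, functions with jumps have finite energy, so \<open>u\<close> may be compared with its truncation
  at a level \<open>l\<close> inside \<open>B\<^sub>t\<close>, unchanged outside. The loss is at most the integral of
  \<open>(t - |x - x\<^sub>0|)\<^bsup>-\<sigma>\<^esup>\<close> over \<open>{u > l}\<close>, and is averaged over \<open>t\<close>; the gain is at least
  \<open>(b' - b)\<^sup>p |{u > b'}| |{u > b}|\<^bsup>-\<beta>\<^esup>\<close> plus the potential energy saved.

  First, levels \<open>K\<^sup>j a\<^sub>0\<close> with \<open>a\<^sub>0\<^sup>m\<close> of order \<open>\<epsilon>\<^sup>\<sigma>\<close> are used: the potential makes \<open>|{v > K\<^sup>j a\<^sub>0}|\<close> decay
  like \<open>A\<^bsup>-j\<^esup>\<close>, while the kinetic gain absorbs the increase of the potential on \<open>{v > 1}\<close>. With \<open>A\<close> a large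
  power of \<open>K\<close> this yields \<open>|{v > a}| \<le> C \<epsilon>\<^bsup>2\<sigma>/\<beta>\<^esup>\<close> for a fixed \<open>a\<close>. This beats the factor \<open>\<epsilon>\<^bsup>-\<sigma>\<^esup>\<close> in a
  De Giorgi iteration with levels between \<open>a\<close> and \<open>2a\<close>, which then gives \<open>|{v > 2a}| = 0\<close>.
\<close>

section \<open>The fractional kernel\<close>

text \<open>The exponent p of the energy enters the kernel only through \<sigma> = sp. Division by
  zero makes the value on the diagonal 0, so lower bounds hold only off the diagonal.\<close>

definition frac_kernel :: "real \<Rightarrow> real ^ 'n \<Rightarrow> real ^ 'n \<Rightarrow> real" where
  "frac_kernel \<sigma> x y = 1 / norm (x - y) powr (real CARD('n) + \<sigma>)"

lemma frac_kernel_nonneg [simp]: "0 \<le> frac_kernel \<sigma> x y"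
  by (simp add: frac_kernel_def)

lemma frac_kernel_commute: "frac_kernel \<sigma> x y = frac_kernel \<sigma> y x"
  by (simp add: frac_kernel_def norm_minus_commute)

text \<open>Tonelli's theorem is applied to products of completed Lebesgue measures; a countable
  cover by Borel sets of finite measure serves the completion as well.\<close>

lemma sigma_finite_lebesgue: "sigma_finite_measure (lebesgue :: 'a::euclidean_space measure)"
proof -
  obtain A :: "'a set set" where A: "countable A" "A \<subseteq> sets lborel" "\<Union>A = space lborel"
     "\<forall>a\<in>A. emeasure lborel a \<noteq> \<infinity>"
    using lborel.sigma_finite_countable by blast
  show ?thesis
  proof
    show "\<exists>A::'a set set. countable A \<and> A \<subseteq> sets lebesgue \<and> \<Union>A = space lebesgue \<and> (\<forall>a\<in>A. emeasure lebesgue a \<noteq> \<infinity>)"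
    proof (intro exI[of _ A] conjI)
      show "A \<subseteq> sets lebesgue" using A(2) by auto
      show "\<forall>a\<in>A. emeasure lebesgue a \<noteq> \<infinity>"
        using A by (auto simp: subset_iff)
    qed (use A in auto)
  qed
qed

lemma pair_sigma_finite_lebesgue:
  "pair_sigma_finite (lebesgue :: 'a::euclidean_space measure) (lebesgue :: 'b::euclidean_space measure)"
  by (intro pair_sigma_finite.intro sigma_finite_lebesgue)

lemma emeasure_lebesgue_ball:
  fixes x :: "real ^ 'n"
  shows "0 \<le> r \<Longrightarrow> emeasure lebesgue (ball x r) = ennreal (unit_ball_vol CARD('n) * r ^ CARD('n))"
  by (simp add: emeasure_ball)

lemma emeasure_lebesgue_finite_of_subset_ball:
  fixes x :: "real ^ 'n"
  assumes "A \<subseteq> ball x r"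
  shows "emeasure lebesgue A < \<infinity>"
proof -
  have "emeasure lebesgue A \<le> emeasure lebesgue (ball x r)"
    by (intro emeasure_mono assms) auto
  also have "\<dots> < \<infinity>" using emeasure_lborel_ball_finite[of x r] by simp
  finally show ?thesis .
qed

lemma frac_kernel_measurable_left [measurable]:
  "(\<lambda>x. frac_kernel \<sigma> x y) \<in> borel_measurable lebesgue"
  unfolding frac_kernel_def by (intro measurable_completion) measurable

text \<open>Dyadic annuli around \<open>y\<close>: \<open>c k\<close> is the kernel at the inner
  radius 2^k d, and \<open>F k\<close> spreads this value over the whole outer ball of radius
  2^(k+1) d. The integrals of the \<open>F k\<close> form a geometric series of ratio
  2^(-\<sigma>).\<close>

lemma frac_kernel_tail:
  fixes y :: "real ^ 'n"
  assumes "0 < \<sigma>" "0 < d"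
  shows "(\<integral>\<^sup>+x\<in>{x. d \<le> norm (x - y)}. ennreal (frac_kernel \<sigma> x y) \<partial>lebesgue)
      \<le> ennreal (unit_ball_vol CARD('n) * 2 ^ CARD('n) / (1 - 2 powr - \<sigma>) * d powr - \<sigma>)"
proof -
  let ?n = "CARD('n)"
  define c where "c k = (2 ^ k * d) powr - (real ?n + \<sigma>)" for k :: nat
  define F where "F k x = ennreal (c k) * indicator (ball y (2 ^ Suc k * d)) x" for k and x :: "real ^ 'n"
  have pw: "ennreal (frac_kernel \<sigma> x y) * indicator {x. d \<le> norm (x - y)} x \<le> (\<Sum>k. F k x)" for x
  proof (cases "d \<le> norm (x - y)")
    case True
    define z where "z = norm (x - y)"
    have z: "d \<le> z" "0 < z" using True assms by (auto simp: z_def)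
    define k where "k = nat \<lfloor>log 2 (z / d)\<rfloor>"
    have l0: "0 \<le> log 2 (z / d)" using z assms by simp
    have "real k \<le> log 2 (z / d)" "log 2 (z / d) < real k + 1"
      unfolding k_def using l0 by linarith+
    then have "2 powr real k \<le> z / d" "z / d < 2 powr (real k + 1)"
      using z assms by (auto simp: le_log_iff log_less_iff)
    then have k: "2 ^ k * d \<le> z" "z < 2 ^ Suc k * d"
      using assms by (auto simp: powr_realpow powr_add field_simps)
    have "frac_kernel \<sigma> x y = z powr - (real ?n + \<sigma>)"
      unfolding frac_kernel_def z_def powr_minus_divide ..
    also have "\<dots> \<le> c k"
      unfolding c_def using k assms by (intro powr_mono2') auto
    finally have "ennreal (frac_kernel \<sigma> x y) \<le> F k x"
      using k by (auto simp: F_def z_def dist_norm norm_minus_commute intro!: ennreal_leI)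
    also have "\<dots> \<le> (\<Sum>k. F k x)"
      using sum_le_suminf[of "\<lambda>k. F k x" "{k}"] by simp
    finally show ?thesis using True by simp
  qed simp
  have "(\<integral>\<^sup>+x\<in>{x. d \<le> norm (x - y)}. ennreal (frac_kernel \<sigma> x y) \<partial>lebesgue)
      \<le> (\<integral>\<^sup>+x. (\<Sum>k. F k x) \<partial>lebesgue)"
    by (intro nn_integral_mono) (rule pw)
  also have "\<dots> = (\<Sum>k. \<integral>\<^sup>+x. F k x \<partial>lebesgue)"
    unfolding F_def by (rule nn_integral_suminf) (intro borel_measurable_times_ennreal borel_measurable_const borel_measurable_indicator, simp)
  also have "\<dots> = (\<Sum>k. ennreal (unit_ball_vol ?n * 2 ^ ?n * d powr - \<sigma> * (2 powr - \<sigma>) ^ k))"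
  proof (rule suminf_cong)
    fix k
    have "(\<integral>\<^sup>+x. F k x \<partial>lebesgue) = ennreal (c k) * emeasure lebesgue (ball y (2 ^ Suc k * d))"
      unfolding F_def by (subst nn_integral_cmult_indicator) auto
    also have "\<dots> = ennreal (c k * (unit_ball_vol ?n * (2 ^ Suc k * d) ^ ?n))"
      using assms by (subst emeasure_lebesgue_ball) (auto simp: ennreal_mult c_def)
    also have "c k * (unit_ball_vol ?n * (2 ^ Suc k * d) ^ ?n) =
        unit_ball_vol ?n * 2 ^ ?n * d powr - \<sigma> * (2 powr - \<sigma>) ^ k"
    proof -
      have exps: "- (real ?n + \<sigma>) = - \<sigma> + - real ?n" by simp
      have "c k = (2 ^ k * d) powr - \<sigma> * (2 ^ k * d) powr - real ?n"
        unfolding c_def exps powr_add ..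
      also have "(2 ^ k * d) powr - real ?n = inverse ((2 ^ k * d) ^ ?n)"
        using assms by (simp add: powr_minus powr_realpow)
      also have "(2 ^ k * d) powr - \<sigma> = d powr - \<sigma> * (2 powr - \<sigma>) ^ k"
        using assms by (simp add: powr_mult powr_powr powr_realpow[symmetric] mult.commute del: powr_realpow)
      finally have c: "c k = d powr - \<sigma> * (2 powr - \<sigma>) ^ k * inverse ((2 ^ k * d) ^ ?n)" .
      have e: "(2 ^ Suc k * d) ^ ?n = 2 ^ ?n * (2 ^ k * d) ^ ?n"
        by (simp only: power_Suc power_mult_distrib mult.assoc)
      define P where "P = (2 ^ k * d) ^ ?n"
      have P0: "P \<noteq> 0" unfolding P_def using assms by simp
      show ?thesis unfolding c e P_def[symmetric] using P0 by simp
    qed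
    finally show "(\<integral>\<^sup>+x. F k x \<partial>lebesgue) = ennreal (unit_ball_vol ?n * 2 ^ ?n * d powr - \<sigma> * (2 powr - \<sigma>) ^ k)" .
  qed
  also have "\<dots> = ennreal (unit_ball_vol ?n * 2 ^ ?n * d powr - \<sigma> * (1 / (1 - 2 powr - \<sigma>)))"
  proof (rule suminf_ennreal_eq)
    have "2 powr - \<sigma> < 1" using assms by (simp add: powr_less_one)
    then show "(\<lambda>k. unit_ball_vol ?n * 2 ^ ?n * d powr - \<sigma> * (2 powr - \<sigma>) ^ k) sums
       (unit_ball_vol ?n * 2 ^ ?n * d powr - \<sigma> * (1 / (1 - 2 powr - \<sigma>)))"
      by (intro sums_mult geometric_sums) auto
  qed auto
  finally show ?thesis by (simp add: mult.commute mult.left_commute)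
qed

text \<open>A ball around \<open>y\<close> of volume twice that of \<open>S\<close> keeps at least
  the volume of \<open>S\<close> after \<open>S\<close> is removed, and on this remainder the kernel
  is at least its value at radius \<open>\<rho>\<close>. The bound is uniform in \<open>y\<close>,
  and small sets \<open>S\<close> give large integrals.\<close>

lemma frac_kernel_complement:
  fixes y :: "real ^ 'n"
  assumes "0 < \<sigma>" and S: "S \<in> sets lebesgue" "emeasure lebesgue S < \<infinity>" "0 < measure lebesgue S"
  shows "ennreal (unit_ball_vol CARD('n) / 2 * (2 / unit_ball_vol CARD('n)) powr - (\<sigma> / CARD('n))
           * measure lebesgue S powr - (\<sigma> / CARD('n)))
      \<le> (\<integral>\<^sup>+x\<in>- S. ennreal (frac_kernel \<sigma> x y) \<partial>lebesgue)"
proof -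
  let ?n = "CARD('n)" let ?w = "unit_ball_vol (real CARD('n))"
  have w: "0 < ?w" by simp
  then have w0: "?w \<noteq> 0" by linarith
  define M where "M = measure lebesgue S"
  have M: "0 < M" "emeasure lebesgue S = ennreal M"
    using S unfolding M_def by (auto simp: emeasure_eq_ennreal_measure)
  define \<rho> where "\<rho> = (2 * M / ?w) powr (1 / ?n)"
  have rho: "0 < \<rho>" unfolding \<rho>_def using M by (simp add: w0)
  have rho_n: "?w * \<rho> ^ ?n = 2 * M"
    unfolding \<rho>_def using M by (simp add: powr_realpow[symmetric] powr_powr w0)
  \<comment> \<open>The centre is removed because the kernel takes the value 0 there.\<close>
  define B where "B = ball y \<rho> - {y} - S"
  have Bs: "B \<in> sets lebesgue" using S unfolding B_def by auto
  have ys: "{y} \<in> sets lebesgue" by simp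
  have "emeasure lebesgue (ball y \<rho>) \<le> emeasure lebesgue (B \<union> {y} \<union> S)"
    by (intro emeasure_mono sets.Un Bs ys S(1)) (auto simp: B_def)
  also have "\<dots> \<le> emeasure lebesgue (B \<union> {y}) + emeasure lebesgue S"
    by (intro emeasure_subadditive sets.Un Bs ys S(1))
  also have "emeasure lebesgue (B \<union> {y}) \<le> emeasure lebesgue B + emeasure lebesgue {y}"
    by (intro emeasure_subadditive Bs ys)
  also have "emeasure lebesgue {y} = 0" by simp
  finally have "ennreal (2 * M) \<le> emeasure lebesgue B + ennreal M"
    using rho by (simp add: emeasure_ball rho_n M add_right_mono)
  then have "ennreal M + ennreal M \<le> emeasure lebesgue B + ennreal M"
    using M by (simp flip: ennreal_plus)
  then have BM: "ennreal M \<le> emeasure lebesgue B"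
    by (simp add: ennreal_add_left_cancel_le add.commute)
  have pw: "ennreal (\<rho> powr - (?n + \<sigma>)) * indicator B x \<le> ennreal (frac_kernel \<sigma> x y) * indicator (- S) x" for x
  proof (cases "x \<in> B")
    case True
    then have x: "0 < norm (x - y)" "norm (x - y) \<le> \<rho>" "x \<notin> S"
      by (auto simp: B_def dist_norm norm_minus_commute)
    then have "\<rho> powr - (?n + \<sigma>) \<le> norm (x - y) powr - (?n + \<sigma>)"
      using assms by (intro powr_mono2') auto
    then have "\<rho> powr - (?n + \<sigma>) \<le> frac_kernel \<sigma> x y"
      unfolding frac_kernel_def powr_minus_divide .
    then show ?thesis using x True by (auto intro!: ennreal_leI)
  qed simp
  have "M * \<rho> powr - (?n + \<sigma>) = ?w / 2 * \<rho> powr - \<sigma>"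
  proof -
    have exps: "- (real ?n + \<sigma>) = - \<sigma> + - real ?n" by simp
    have "\<rho> powr - (?n + \<sigma>) = \<rho> powr - \<sigma> * \<rho> powr - real ?n"
      unfolding exps powr_add ..
    also have "\<rho> powr - real ?n = inverse (\<rho> ^ ?n)" using rho by (simp add: powr_minus powr_realpow)
    also have "\<rho> ^ ?n = 2 * M / ?w" using rho_n by (simp add: w0 field_simps)
    finally show ?thesis using M by (simp add: w0)
  qed
  also have "\<rho> powr - \<sigma> = (2 / ?w) powr - (\<sigma> / ?n) * M powr - (\<sigma> / ?n)"
    unfolding \<rho>_def using M w by (simp add: powr_powr powr_mult[symmetric])
  finally have eq: "M * \<rho> powr - (?n + \<sigma>) = ?w / 2 * (2 / ?w) powr - (\<sigma> / ?n) * M powr - (\<sigma> / ?n)"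
    by simp
  have "ennreal (M * \<rho> powr - (?n + \<sigma>)) \<le> ennreal (\<rho> powr - (?n + \<sigma>)) * emeasure lebesgue B"
    using mult_left_mono[OF BM, of "ennreal (\<rho> powr - (?n + \<sigma>))"] M
    by (subst ennreal_mult) (simp_all add: mult.commute)
  also have "\<dots> = (\<integral>\<^sup>+x. ennreal (\<rho> powr - (?n + \<sigma>)) * indicator B x \<partial>lebesgue)"
    using Bs by (subst nn_integral_cmult_indicator) auto
  also have "\<dots> \<le> (\<integral>\<^sup>+x\<in>- S. ennreal (frac_kernel \<sigma> x y) \<partial>lebesgue)"
    by (intro nn_integral_mono pw)
  finally show ?thesis unfolding eq unfolding M_def .
qed

section \<open>Averaging over the radius of truncation\<close>

lemma nn_integral_powr_shift:
  fixes \<sigma> :: real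
  assumes "\<sigma> < 1" "a \<le> b"
  shows "(\<integral>\<^sup>+t\<in>{a..b}. ennreal ((t - a) powr - \<sigma>) \<partial>lborel) = ennreal ((b - a) powr (1 - \<sigma>) / (1 - \<sigma>))"
proof -
  have "((\<lambda>t. t powr - \<sigma>) has_integral (b - a) powr (- \<sigma> + 1) / (- \<sigma> + 1)) {0..b - a}"
    using assms by (intro has_integral_powr_from_0) auto
  then have "((\<lambda>t. (t - a) powr - \<sigma>) has_integral (b - a) powr (1 - \<sigma>) / (1 - \<sigma>)) {a..b}"
    using has_integral_shift_Icc_real[of "\<lambda>t. (t - a) powr - \<sigma>" a _ 0 "b - a"]
    by (simp add: o_def)
  then show ?thesis
    by (intro nn_integral_has_integral_lebesgue') auto
qed

text \<open>A mean value argument: if every radius violated the bound, integration over the radii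
  and an exchange of the integrals would contradict the estimate by \<open>h\<close> of the inner
  integral over \<open>t\<close>. A single radius may be bad because \<open>A\<close> can
  concentrate near the corresponding sphere.\<close>

lemma ex_radius_boundary_integral_le:
  fixes x0 :: "real ^ 'n"
  assumes \<sigma>: "0 < \<sigma>" "\<sigma> < 1" and \<rho>: "\<rho>' < \<rho>"
    and A: "A \<in> sets lebesgue" "A \<subseteq> ball x0 \<rho>"
  shows "\<exists>t\<in>{\<rho>'<..<\<rho>}. (\<integral>\<^sup>+y\<in>A \<inter> ball x0 t. ennreal ((t - dist x0 y) powr - \<sigma>) \<partial>lebesgue)
           \<le> ennreal (2 / (1 - \<sigma>) * (\<rho> - \<rho>') powr - \<sigma> * measure lebesgue A)"
proof (rule ccontr)
  assume no: "\<not> ?thesis"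
  define b where "b = 2 / (1 - \<sigma>) * (\<rho> - \<rho>') powr - \<sigma> * measure lebesgue A"
  define I where "I t = (\<integral>\<^sup>+y\<in>A \<inter> ball x0 t. ennreal ((t - dist x0 y) powr - \<sigma>) \<partial>lebesgue)" for t
  have gt: "ennreal b < I t" if "t \<in> {\<rho>'<..<\<rho>}" for t
    using no that unfolding I_def b_def by (auto simp: not_le)
  have finA: "emeasure lebesgue A < \<infinity>"
    using A(2) by (rule emeasure_lebesgue_finite_of_subset_ball)
  then have emA: "emeasure lebesgue A = ennreal (measure lebesgue A)"
    by (intro emeasure_eq_ennreal_measure) auto
  \<comment> \<open>For a null set \<open>A\<close> the strict violation already fails at the
    midpoint. Positive measure makes the final contradiction strict.\<close>
  have mA: "0 < measure lebesgue A"
  proof (rule ccontr)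
    assume "\<not> 0 < measure lebesgue A"
    then have m0: "measure lebesgue A = 0" using measure_nonneg[of lebesgue A] by linarith
    then have "A \<in> null_sets lebesgue" using emA A(1) by (auto simp: null_sets_def)
    then have "AE y in lebesgue. y \<notin> A" by (rule AE_not_in)
    moreover have "(\<rho>' + \<rho>) / 2 \<in> {\<rho>'<..<\<rho>}" using \<rho> by auto
    ultimately have "I ((\<rho>' + \<rho>) / 2) = (\<integral>\<^sup>+y. 0 \<partial>(lebesgue :: (real ^ 'n) measure))"
      unfolding I_def by (intro nn_integral_cong_AE) auto
    moreover have "0 < I ((\<rho>' + \<rho>) / 2)"
      using gt[of "(\<rho>' + \<rho>) / 2"] \<rho> by (auto simp: le_less_trans)
    ultimately show False by simp
  qed
  define h where "h = (\<rho> - \<rho>') powr (1 - \<sigma>) / (1 - \<sigma>)"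
  have h: "0 < h" unfolding h_def using \<rho> \<sigma> by simp
  \<comment> \<open>The factor 2 in the claimed bound makes the lower estimate twice the upper
    one.\<close>
  have bh: "b * (\<rho> - \<rho>') = 2 * (h * measure lebesgue A)"
    unfolding b_def h_def using \<rho> powr_add[of "\<rho> - \<rho>'" "- \<sigma>" 1] by simp
  have b0: "0 \<le> b" unfolding b_def using \<sigma> by auto
  interpret pair_sigma_finite "lebesgue :: (real ^ 'n) measure" "lborel :: real measure"
    by (intro pair_sigma_finite.intro sigma_finite_lebesgue sigma_finite_lborel)
  define F where "F y t = indicator A y * (indicator {\<rho>'<..<\<rho>} t *
      (if dist x0 y < t then ennreal ((t - dist x0 y) powr - \<sigma>) else 0))" for y t
  have dm [measurable]: "(\<lambda>y. dist x0 y) \<in> borel_measurable lebesgue"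
    by (intro measurable_completion) measurable
  have Fm: "(\<lambda>(y, t). F y t) \<in> borel_measurable (lebesgue \<Otimes>\<^sub>M lborel)"
    unfolding F_def using A(1) by measurable
  have "ennreal (b * (\<rho> - \<rho>')) = (\<integral>\<^sup>+t. ennreal b * indicator {\<rho>'<..<\<rho>} t \<partial>lborel)"
    using \<rho> b0 by (subst nn_integral_cmult_indicator) (auto simp: ennreal_mult)
  also have "\<dots> \<le> (\<integral>\<^sup>+t. (\<integral>\<^sup>+y. F y t \<partial>lebesgue) \<partial>lborel)"
  proof (rule nn_integral_mono)
    fix t
    show "ennreal b * indicator {\<rho>'<..<\<rho>} t \<le> (\<integral>\<^sup>+y. F y t \<partial>lebesgue)"
    proof (cases "t \<in> {\<rho>'<..<\<rho>}")
      case True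
      have "I t = (\<integral>\<^sup>+y. F y t \<partial>lebesgue)"
        unfolding I_def F_def using True by (intro nn_integral_cong) (auto simp: indicator_def)
      then show ?thesis using gt[OF True] True by simp
    qed simp
  qed
  also have "\<dots> = (\<integral>\<^sup>+y. (\<integral>\<^sup>+t. F y t \<partial>lborel) \<partial>lebesgue)"
    by (rule Fubini'[OF Fm])
  also have "\<dots> \<le> (\<integral>\<^sup>+y. ennreal h * indicator A y \<partial>lebesgue)"
  proof (rule nn_integral_mono)
    fix y
    show "(\<integral>\<^sup>+t. F y t \<partial>lborel) \<le> ennreal h * indicator A y"
    proof (cases "y \<in> A")
      case True
      \<comment> \<open>Only radii above both numbers contribute, and replacing
        \<open>dist x0 y\<close> by the larger \<open>a\<close> increases the negative power. The
        resulting singularity at \<open>a\<close> is integrable because \<sigma> < 1.\<close>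
      define a where "a = max (dist x0 y) \<rho>'"
      have a: "dist x0 y \<le> a" "\<rho>' \<le> a" "a \<le> \<rho>" using True A(2) \<rho> by (auto simp: a_def)
      have "(\<integral>\<^sup>+t. F y t \<partial>lborel) \<le> (\<integral>\<^sup>+t\<in>{a..\<rho>}. ennreal ((t - a) powr - \<sigma>) \<partial>lborel)"
      proof (rule nn_integral_mono_AE)
        have "AE t in lborel. t \<noteq> a" by (rule AE_lborel_singleton)
        then show "AE t in lborel. F y t \<le> ennreal ((t - a) powr - \<sigma>) * indicator {a..\<rho>} t"
        proof eventually_elim
          case (elim t)
          show ?case
          proof (cases "t \<in> {\<rho>'<..<\<rho>} \<and> dist x0 y < t")
            case t: True
            then have "a < t" using elim by (auto simp: a_def)
            then have "(t - dist x0 y) powr - \<sigma> \<le> (t - a) powr - \<sigma>"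
              using a \<sigma> by (intro powr_mono2') auto
            then show ?thesis using t True \<open>a < t\<close> by (auto simp: F_def intro!: ennreal_leI)
          qed (auto simp: F_def)
        qed
      qed
      also have "\<dots> = ennreal ((\<rho> - a) powr (1 - \<sigma>) / (1 - \<sigma>))"
        using \<sigma> a by (intro nn_integral_powr_shift) auto
      also have "\<dots> \<le> ennreal h"
        unfolding h_def using \<sigma> a by (intro ennreal_leI divide_right_mono powr_mono2) auto
      finally show ?thesis using True by simp
    qed (simp add: F_def)
  qed
  also have "\<dots> = ennreal (h * measure lebesgue A)"
    using A(1) h emA by (subst nn_integral_cmult_indicator) (auto simp: ennreal_mult simp del: emeasure_completion)
  finally have "b * (\<rho> - \<rho>') \<le> h * measure lebesgue A"
    using h by (subst (asm) ennreal_le_iff) auto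
  moreover have "0 < h * measure lebesgue A" using h mA by simp
  ultimately show False unfolding bh by linarith
qed

section \<open>Truncation in a ball\<close>

lemma gagliardo_kernel_eq:
  fixes x y :: "real ^ 'n"
  shows "gagliardo_kernel s p u x y = \<bar>u x - u y\<bar> powr p * frac_kernel (s * p) x y"
  by (simp add: gagliardo_kernel_def frac_kernel_def)

lemma nn_integral_iterated_add:
  fixes f g :: "real ^ 'n \<Rightarrow> real ^ 'n \<Rightarrow> ennreal"
  assumes f: "(\<lambda>(y, x). f y x) \<in> borel_measurable (lebesgue \<Otimes>\<^sub>M lebesgue)"
    and g: "(\<lambda>(y, x). g y x) \<in> borel_measurable (lebesgue \<Otimes>\<^sub>M lebesgue)"
  shows "(\<integral>\<^sup>+y. (\<integral>\<^sup>+x. f y x + g y x \<partial>lebesgue) \<partial>lebesgue) =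
    (\<integral>\<^sup>+y. (\<integral>\<^sup>+x. f y x \<partial>lebesgue) \<partial>lebesgue) + (\<integral>\<^sup>+y. (\<integral>\<^sup>+x. g y x \<partial>lebesgue) \<partial>lebesgue)"
proof -
  interpret L: sigma_finite_measure "lebesgue :: (real ^ 'n) measure" by (rule sigma_finite_lebesgue)
  have fm: "(\<lambda>y. \<integral>\<^sup>+x. f y x \<partial>lebesgue) \<in> borel_measurable lebesgue"
    using L.borel_measurable_nn_integral[OF f] .
  have gm: "(\<lambda>y. \<integral>\<^sup>+x. g y x \<partial>lebesgue) \<in> borel_measurable lebesgue"
    using L.borel_measurable_nn_integral[OF g] .
  have f1: "f y \<in> borel_measurable lebesgue" for y
    using measurable_compose[OF measurable_Pair1' f, of y] by simp
  have g1: "g y \<in> borel_measurable lebesgue" for y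
    using measurable_compose[OF measurable_Pair1' g, of y] by simp
  have "(\<integral>\<^sup>+x. f y x + g y x \<partial>lebesgue) = (\<integral>\<^sup>+x. f y x \<partial>lebesgue) + (\<integral>\<^sup>+x. g y x \<partial>lebesgue)" for y
    by (intro nn_integral_add f1 g1)
  then show ?thesis by (simp add: nn_integral_add fm gm)
qed

lemma frac_kernel_measurable_pair [measurable]:
  "(\<lambda>(y, x). frac_kernel \<sigma> x y) \<in> borel_measurable (lebesgue \<Otimes>\<^sub>M (lebesgue :: (real ^ 'n) measure))"
proof -
  have [measurable]: "(\<lambda>x :: real ^ 'n. x) \<in> lebesgue \<rightarrow>\<^sub>M borel"
    by (intro measurable_completion) measurable
  show ?thesis unfolding frac_kernel_def by measurable
qed

text \<open>This weight turns the two double integrals of the kinetic energy into one.\<close>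

definition energy_weight :: "'a set \<Rightarrow> 'a \<Rightarrow> 'a \<Rightarrow> ennreal" where
  "energy_weight \<Omega> y x = indicator \<Omega> y * (ennreal (1 / 2) * indicator \<Omega> x + indicator (- \<Omega>) x)"

lemma ennreal_half_le_1: "ennreal (1 / 2) \<le> 1"
  by (subst ennreal_le_1) simp

lemma energy_weight_le_1: "energy_weight \<Omega> y x \<le> 1"
  using ennreal_half_le_1 by (auto simp: energy_weight_def indicator_def)

lemma energy_weight_ge_half: "y \<in> \<Omega> \<Longrightarrow> ennreal (1 / 2) \<le> energy_weight \<Omega> y x"
  using ennreal_half_le_1 by (auto simp: energy_weight_def indicator_def)

lemma energy_weight_measurable:
  assumes "\<Omega> \<in> sets (lebesgue :: (real ^ 'n) measure)"
  shows "(\<lambda>(y, x). energy_weight \<Omega> y x) \<in> borel_measurable (lebesgue \<Otimes>\<^sub>M (lebesgue :: (real ^ 'n) measure))"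
  using assms unfolding energy_weight_def by measurable

lemma kinetic_energy_eq:
  fixes u :: "real ^ 'n \<Rightarrow> real"
  assumes u: "u \<in> borel_measurable lebesgue" and \<Omega>: "\<Omega> \<in> sets lebesgue"
  shows "kinetic_energy s p u \<Omega> =
    (\<integral>\<^sup>+y. (\<integral>\<^sup>+x. energy_weight \<Omega> y x * ennreal (gagliardo_kernel s p u x y) \<partial>lebesgue) \<partial>lebesgue)"
proof -
  let ?k = "\<lambda>y x. ennreal (gagliardo_kernel s p u x y)"
  have km: "(\<lambda>(y, x). ?k y x) \<in> borel_measurable (lebesgue \<Otimes>\<^sub>M lebesgue)"
    unfolding gagliardo_kernel_eq using u by measurable
  have km1: "?k y \<in> borel_measurable lebesgue" for y
    using measurable_compose[OF measurable_Pair1' km, of y] by simp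
  have m1: "(\<lambda>(y, x). indicator \<Omega> y * (ennreal (1 / 2) * (?k y x * indicator \<Omega> x)))
      \<in> borel_measurable (lebesgue \<Otimes>\<^sub>M lebesgue)"
    using km \<Omega> by measurable
  have m2: "(\<lambda>(y, x). indicator \<Omega> y * (?k y x * indicator (- \<Omega>) x))
      \<in> borel_measurable (lebesgue \<Otimes>\<^sub>M lebesgue)"
    using km \<Omega> by measurable
  interpret L: sigma_finite_measure "lebesgue :: (real ^ 'n) measure" by (rule sigma_finite_lebesgue)
  have mk: "(\<lambda>(y, x). ?k y x * indicator \<Omega> x) \<in> borel_measurable (lebesgue \<Otimes>\<^sub>M lebesgue)"
    using km \<Omega> by measurable
  have m3: "(\<lambda>y. \<integral>\<^sup>+x. ?k y x * indicator \<Omega> x \<partial>lebesgue) \<in> borel_measurable lebesgue"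
    using L.borel_measurable_nn_integral[OF mk] .
  have c1: "(\<integral>\<^sup>+y. (\<integral>\<^sup>+x. indicator \<Omega> y * (ennreal (1 / 2) * (?k y x * indicator \<Omega> x)) \<partial>lebesgue) \<partial>lebesgue)
     = ennreal (1 / 2) * (\<integral>\<^sup>+y\<in>\<Omega>. (\<integral>\<^sup>+x\<in>\<Omega>. ?k y x \<partial>lebesgue) \<partial>lebesgue)"
  proof -
    have "(\<integral>\<^sup>+x. indicator \<Omega> y * (ennreal (1 / 2) * (?k y x * indicator \<Omega> x)) \<partial>lebesgue) =
       ennreal (1 / 2) * ((\<integral>\<^sup>+x\<in>\<Omega>. ?k y x \<partial>lebesgue) * indicator \<Omega> y)" for y
    proof -
      have i: "(\<lambda>x. ?k y x * indicator \<Omega> x) \<in> borel_measurable lebesgue"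
        using km1 \<Omega> by measurable
      show ?thesis
        by (cases "y \<in> \<Omega>") (auto simp: nn_integral_cmult[OF i])
    qed
    then show ?thesis using m3 \<Omega> by (simp add: nn_integral_cmult)
  qed
  have c2: "(\<integral>\<^sup>+y. (\<integral>\<^sup>+x. indicator \<Omega> y * (?k y x * indicator (- \<Omega>) x) \<partial>lebesgue) \<partial>lebesgue)
     = (\<integral>\<^sup>+y\<in>\<Omega>. (\<integral>\<^sup>+x\<in>- \<Omega>. ?k y x \<partial>lebesgue) \<partial>lebesgue)"
    by (intro nn_integral_cong) (auto simp: indicator_def)
  have "kinetic_energy s p u \<Omega> =
    (\<integral>\<^sup>+y. (\<integral>\<^sup>+x. indicator \<Omega> y * (ennreal (1 / 2) * (?k y x * indicator \<Omega> x))
       + indicator \<Omega> y * (?k y x * indicator (- \<Omega>) x) \<partial>lebesgue) \<partial>lebesgue)"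
    unfolding nn_integral_iterated_add[OF m1 m2] c1 c2 kinetic_energy_def ..
  also have "\<dots> = (\<integral>\<^sup>+y. (\<integral>\<^sup>+x. energy_weight \<Omega> y x * ?k y x \<partial>lebesgue) \<partial>lebesgue)"
    unfolding energy_weight_def
    by (intro nn_integral_cong) (auto simp: indicator_def)
  finally show ?thesis .
qed

section \<open>Change of the kinetic energy under truncation\<close>

lemma powr_add_le_powr:
  fixes a b p :: real
  assumes "0 \<le> a" "0 \<le> b" "1 \<le> p"
  shows "a powr p + b powr p \<le> (a + b) powr p"
proof (cases "a + b = 0")
  case False
  then have ab: "0 < a + b" using assms by linarith
  have *: "t powr p \<le> t * (a + b) powr (p - 1)" if "0 \<le> t" "t \<le> a + b" for t
  proof (cases "t = 0")
    case False
    then have "t powr p = t * t powr (p - 1)" using that powr_add[of t 1 "p - 1"] by simp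
    also have "\<dots> \<le> t * (a + b) powr (p - 1)"
      using that assms by (intro mult_left_mono powr_mono2) auto
    finally show ?thesis .
  qed simp
  have "a powr p + b powr p \<le> a * (a + b) powr (p - 1) + b * (a + b) powr (p - 1)"
    using assms by (intro add_mono *) auto
  also have "\<dots> = (a + b) powr p"
    using ab powr_add[of "a + b" 1 "p - 1"] by (simp add: algebra_simps)
  finally show ?thesis .
next
  case True
  then have "a = 0" "b = 0" using assms by auto
  then show ?thesis by simp
qed

text \<open>Inside \<open>B\<close> truncation does not increase differences, and for
  \<open>u x \<le> b \<le> b' < u y\<close> the difference drops by at least \<open>b' - b\<close>,
  which superadditivity of the p-th power turns into a gain. A loss arises only when exactly one
  point lies in \<open>B\<close> and is truncated. Pairs with \<open>x\<close> outside
  \<open>B\<close> are counted as gain too, so that the gain region in \<open>x\<close> is the full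
  complement of the superlevel set; this is paid for by the loss constant, 2^p for the new
  difference and 2^p for the gain.\<close>

lemma truncation_pointwise:
  fixes u :: "'a \<Rightarrow> real" and B :: "'a set"
  assumes p: "1 \<le> p" and l: "-1 \<le> l" "l \<le> b" "b \<le> b'" and ux: "\<bar>u x\<bar> \<le> 1" and uy: "\<bar>u y\<bar> \<le> 1"
    and l1: "l \<le> 1"
  defines "w \<equiv> (\<lambda>z. if z \<in> B then min (u z) l else u z)"
  shows "\<bar>w x - w y\<bar> powr p + (b' - b) powr p * (of_bool (y \<in> B \<and> b' < u y \<and> \<not> (x \<in> B \<and> b < u x)))
    \<le> \<bar>u x - u y\<bar> powr p + 2 powr (p + 1) * (of_bool (y \<in> B \<and> l < u y \<and> x \<notin> B) + of_bool (x \<in> B \<and> l < u x \<and> y \<notin> B))"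
proof -
  have w: "\<bar>w z\<bar> \<le> 1" if "\<bar>u z\<bar> \<le> 1" for z using that l l1 by (auto simp: w_def)
  have p2: "2 powr (p + 1) = 2 powr p + 2 powr p" by (simp add: powr_add)
  have wb: "\<bar>w x - w y\<bar> powr p \<le> 2 powr p"
    using w[OF ux] w[OF uy] p by (intro powr_mono2) auto
  have p0: "0 \<le> \<bar>u x - u y\<bar> powr p" by simp
  consider "x \<in> B" "y \<in> B" | "x \<notin> B" "y \<in> B" | "x \<in> B" "y \<notin> B" | "x \<notin> B" "y \<notin> B" by blast
  then show ?thesis
  proof cases
    case 1
    show ?thesis
    proof (cases "b' < u y \<and> u x \<le> b")
      case True
      have "\<bar>w x - w y\<bar> powr p + (b' - b) powr p \<le> (\<bar>w x - w y\<bar> + (b' - b)) powr p"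
        using l p by (intro powr_add_le_powr) auto
      also have "\<dots> \<le> \<bar>u x - u y\<bar> powr p"
        using True 1 l p by (intro powr_mono2) (auto simp: w_def min_def)
      finally show ?thesis using 1 True by simp
    next
      case False
      have "\<bar>w x - w y\<bar> powr p \<le> \<bar>u x - u y\<bar> powr p"
        using 1 p by (intro powr_mono2) (auto simp: w_def min_def)
      then show ?thesis using 1 False by (auto simp: not_le)
    qed
  next
    case 2
    show ?thesis
    proof (cases "l < u y")
      case True
      have le: "(b' - b) powr p * of_bool (b' < u y) \<le> 2 powr p"
        using l uy p by (auto intro!: powr_mono2)
      have "\<bar>w x - w y\<bar> powr p + (b' - b) powr p * of_bool (b' < u y) \<le> \<bar>u x - u y\<bar> powr p + 2 powr (p + 1)"
        using wb le p0 p2 by linarith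
      then show ?thesis using 2 True by simp
    next
      case False
      then show ?thesis using 2 l by (auto simp: w_def)
    qed
  next
    case 3
    show ?thesis
    proof (cases "l < u x")
      case True
      have "0 \<le> (2::real) powr p" by simp
      then have "\<bar>w x - w y\<bar> powr p \<le> \<bar>u x - u y\<bar> powr p + 2 powr (p + 1)"
        using wb p0 p2 by linarith
      then show ?thesis using 3 True by simp
    next
      case False
      then show ?thesis using 3 by (auto simp: w_def)
    qed
  qed (auto simp: w_def)
qed

text \<open>The constant of \<open>frac_kernel_complement\<close> times 1/2, the lower bound of
  \<open>energy_weight\<close>.\<close>

definition gain_const :: "nat \<Rightarrow> real \<Rightarrow> real" where
  "gain_const n \<sigma> = unit_ball_vol n / 4 * (2 / unit_ball_vol n) powr - (\<sigma> / n)"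

text \<open>The constant of \<open>frac_kernel_tail\<close> times 2^(p+1) from
  \<open>truncation_pointwise\<close>, doubled because either point of the pair may be the one
  inside the ball.\<close>

definition loss_const :: "nat \<Rightarrow> real \<Rightarrow> real \<Rightarrow> real" where
  "loss_const n \<sigma> p = 2 powr (p + 2) * (unit_ball_vol n * 2 ^ n / (1 - 2 powr - \<sigma>))"

lemma gain_const_pos: "0 < gain_const n \<sigma>"
proof -
  have "0 < unit_ball_vol (real n)" by simp
  then have "unit_ball_vol (real n) \<noteq> 0" by linarith
  then show ?thesis unfolding gain_const_def by simp
qed

lemma loss_const_pos: "0 < \<sigma> \<Longrightarrow> 0 < loss_const n \<sigma> p"
proof -
  assume "0 < \<sigma>"
  then have "2 powr - \<sigma> < 1" by (simp add: powr_less_one)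
  then show ?thesis unfolding loss_const_def by simp
qed

lemma Xsp_D:
  assumes "u \<in> Xsp s p \<Omega>"
  shows "u \<in> borel_measurable lebesgue" "kinetic_energy s p u \<Omega> < \<infinity>"
    "AE x in lebesgue. \<bar>u x\<bar> \<le> 1"
proof -
  show um: "u \<in> borel_measurable lebesgue" and "kinetic_energy s p u \<Omega> < \<infinity>"
    using assms by (auto simp: Xsp_def)
  have "AE x in lebesgue. ereal \<bar>u x\<bar> \<le> esssup lebesgue (\<lambda>x. ereal \<bar>u x\<bar>)"
    by (rule esssup_AE)
  moreover have "esssup lebesgue (\<lambda>x. ereal \<bar>u x\<bar>) \<le> 1" using assms by (simp add: Xsp_def)
  ultimately show "AE x in lebesgue. \<bar>u x\<bar> \<le> 1"
    by (auto elim!: eventually_mono dest: order_trans)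
qed

lemma superlevel_lebesgue:
  fixes u :: "real ^ 'n \<Rightarrow> real"
  assumes "u \<in> borel_measurable lebesgue"
  shows "{x \<in> ball x0 t. c < u x} \<in> sets lebesgue"
proof -
  have "{x \<in> space lebesgue. c < u x} \<in> sets lebesgue" using assms by measurable
  moreover have "{x \<in> ball x0 t. c < u x} = ball x0 t \<inter> {x \<in> space lebesgue. c < u x}" by auto
  ultimately show ?thesis by (auto intro!: sets.Int)
qed

text \<open>Each \<open>y\<close> in \<open>X\<close> sees the whole complement of \<open>S\<close>,
  so \<open>frac_kernel_complement\<close> bounds the inner integral from below and only the measure
  of \<open>X\<close> remains.\<close>

lemma kinetic_gain:
  fixes \<Omega> :: "(real ^ 'n) set"
  assumes \<sigma>: "0 < \<sigma>" and S: "S \<in> sets lebesgue" "emeasure lebesgue S < \<infinity>"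
    and X: "X \<in> sets lebesgue" "X \<subseteq> S" "X \<subseteq> \<Omega>" and d: "0 \<le> d"
  shows "ennreal (gain_const CARD('n) \<sigma> * d * measure lebesgue X * measure lebesgue S powr - (\<sigma> / CARD('n)))
    \<le> (\<integral>\<^sup>+y. (\<integral>\<^sup>+x. energy_weight \<Omega> y x * (ennreal d *
          (indicator X y * (ennreal (frac_kernel \<sigma> x y) * indicator (- S) x))) \<partial>lebesgue) \<partial>lebesgue)"
\<comment> \<open>If \<open>S\<close> is a null set the left side is 0, since \<open>0 powr\<close>
  any exponent is 0.\<close>
proof (cases "measure lebesgue S = 0")
  case False
  then have S0: "0 < measure lebesgue S" by (simp add: zero_less_measure_iff)
  let ?n = "CARD('n)"
  have "emeasure lebesgue X \<le> emeasure lebesgue S" using S X by (intro emeasure_mono) auto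
  then have emX: "emeasure lebesgue X = ennreal (measure lebesgue X)"
    using S(2) by (intro emeasure_eq_ennreal_measure) auto
  define c where "c = unit_ball_vol ?n / 2 * (2 / unit_ball_vol ?n) powr - (\<sigma> / ?n) * measure lebesgue S powr - (\<sigma> / ?n)"
  have c0: "0 \<le> c" unfolding c_def by simp
  have "ennreal (gain_const ?n \<sigma> * d * measure lebesgue X * measure lebesgue S powr - (\<sigma> / ?n))
      = ennreal (1 / 2 * d * c * measure lebesgue X)"
    unfolding gain_const_def c_def by (simp add: algebra_simps)
  also have "\<dots> = ennreal (1 / 2 * d * c) * emeasure lebesgue X"
    unfolding emX using d c0 by (intro ennreal_mult) auto
  also have "\<dots> = (\<integral>\<^sup>+y. ennreal (1 / 2 * d * c) * indicator X y \<partial>lebesgue)"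
    using X by (subst nn_integral_cmult_indicator) auto
  also have "\<dots> \<le> (\<integral>\<^sup>+y. (\<integral>\<^sup>+x. energy_weight \<Omega> y x * (ennreal d *
          (indicator X y * (ennreal (frac_kernel \<sigma> x y) * indicator (- S) x))) \<partial>lebesgue) \<partial>lebesgue)"
  proof (rule nn_integral_mono)
    fix y :: "real ^ 'n"
    show "ennreal (1 / 2 * d * c) * indicator X y \<le> (\<integral>\<^sup>+x. energy_weight \<Omega> y x * (ennreal d *
          (indicator X y * (ennreal (frac_kernel \<sigma> x y) * indicator (- S) x))) \<partial>lebesgue)"
    proof (cases "y \<in> X")
      case True
      have m: "(\<lambda>x. ennreal (frac_kernel \<sigma> x y) * indicator (- S) x) \<in> borel_measurable lebesgue"
        using S by measurable
      have "ennreal (1 / 2 * d * c) = ennreal (1 / 2 * d) * ennreal c"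
        using d c0 by (intro ennreal_mult) auto
      also have "\<dots> \<le> ennreal (1 / 2 * d) * (\<integral>\<^sup>+x\<in>- S. ennreal (frac_kernel \<sigma> x y) \<partial>lebesgue)"
        unfolding c_def by (intro mult_left_mono frac_kernel_complement \<sigma> S S0) auto
      also have "\<dots> = (\<integral>\<^sup>+x. ennreal (1 / 2 * d) * (ennreal (frac_kernel \<sigma> x y) * indicator (- S) x) \<partial>lebesgue)"
        by (rule nn_integral_cmult[symmetric, OF m])
      also have "\<dots> = (\<integral>\<^sup>+x. ennreal (1 / 2) * (ennreal d * (ennreal (frac_kernel \<sigma> x y) * indicator (- S) x)) \<partial>lebesgue)"
        using d by (subst ennreal_mult) (auto simp: mult.assoc)
      also have "\<dots> \<le> (\<integral>\<^sup>+x. energy_weight \<Omega> y x * (ennreal d * (ennreal (frac_kernel \<sigma> x y) * indicator (- S) x)) \<partial>lebesgue)"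
        using True X by (intro nn_integral_mono mult_right_mono energy_weight_ge_half) auto
      finally show ?thesis using True by simp
    qed simp
  qed
  finally show ?thesis .
qed simp

text \<open>The two terms have equal integrals by Tonelli. For \<open>y\<close> in \<open>P\<close>
  the complement of the ball lies at distance at least \<open>t - dist x0 y\<close> from
  \<open>y\<close>, so the kernel tail produces the singular boundary weight.\<close>

lemma kinetic_loss:
  fixes \<Omega> P :: "(real ^ 'n) set"
  assumes \<sigma>: "0 < \<sigma>" and P: "P \<in> sets lebesgue" "P \<subseteq> ball x0 t"
  shows "(\<integral>\<^sup>+y. (\<integral>\<^sup>+x. energy_weight \<Omega> y x * (ennreal (2 powr (p + 1)) *
      (indicator P y * (ennreal (frac_kernel \<sigma> x y) * indicator (- ball x0 t) x)
        + indicator P x * (ennreal (frac_kernel \<sigma> y x) * indicator (- ball x0 t) y))) \<partial>lebesgue) \<partial>lebesgue)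
    \<le> ennreal (loss_const CARD('n) \<sigma> p) * (\<integral>\<^sup>+y\<in>P. ennreal ((t - dist x0 y) powr - \<sigma>) \<partial>lebesgue)"
proof -
  let ?n = "CARD('n)"
  let ?B = "ball x0 t"
  define T where "T y x = indicator P y * (ennreal (frac_kernel \<sigma> x y) * indicator (- ?B) x)" for y x
  have B: "?B \<in> sets lebesgue" by simp
  have Tm: "(\<lambda>(y, x). T y x) \<in> borel_measurable (lebesgue \<Otimes>\<^sub>M lebesgue)"
    unfolding T_def using P B frac_kernel_measurable_pair[of \<sigma>] by measurable
  have Tm': "(\<lambda>(y, x). T x y) \<in> borel_measurable (lebesgue \<Otimes>\<^sub>M lebesgue)"
    using measurable_pair_swap[OF Tm] by (simp add: case_prod_beta')
  have cTm: "(\<lambda>(y, x). ennreal (2 powr (p + 1)) * T y x) \<in> borel_measurable (lebesgue \<Otimes>\<^sub>M lebesgue)"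
    using borel_measurable_times_ennreal[OF borel_measurable_const Tm] by (simp add: case_prod_beta')
  have cTm': "(\<lambda>(y, x). ennreal (2 powr (p + 1)) * T x y) \<in> borel_measurable (lebesgue \<Otimes>\<^sub>M lebesgue)"
    using borel_measurable_times_ennreal[OF borel_measurable_const Tm'] by (simp add: case_prod_beta')
  interpret pair_sigma_finite "lebesgue :: (real ^ 'n) measure" "lebesgue :: (real ^ 'n) measure"
    by (rule pair_sigma_finite_lebesgue)
  define K where "K = unit_ball_vol ?n * 2 ^ ?n / (1 - 2 powr - \<sigma>)"
  have K0: "0 \<le> K" unfolding K_def using \<sigma> powr_less_one[of 2 "- \<sigma>"] by simp
  define I where "I = (\<integral>\<^sup>+y\<in>P. ennreal ((t - dist x0 y) powr - \<sigma>) \<partial>lebesgue)"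
  have dm [measurable]: "(\<lambda>y. dist x0 y) \<in> borel_measurable lebesgue"
    by (intro measurable_completion) measurable
  have TI: "(\<integral>\<^sup>+y. (\<integral>\<^sup>+x. T y x \<partial>lebesgue) \<partial>lebesgue) \<le> ennreal K * I"
  proof -
    have Im: "(\<lambda>y. ennreal ((t - dist x0 y) powr - \<sigma>) * indicator P y) \<in> borel_measurable lebesgue"
      using P by measurable
    have "(\<integral>\<^sup>+y. (\<integral>\<^sup>+x. T y x \<partial>lebesgue) \<partial>lebesgue)
        \<le> (\<integral>\<^sup>+y. ennreal K * (ennreal ((t - dist x0 y) powr - \<sigma>) * indicator P y) \<partial>lebesgue)"
    proof (rule nn_integral_mono)
      fix y
      show "(\<integral>\<^sup>+x. T y x \<partial>lebesgue) \<le> ennreal K * (ennreal ((t - dist x0 y) powr - \<sigma>) * indicator P y)"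
      proof (cases "y \<in> P")
        case True
        then have d: "0 < t - dist x0 y" using P by auto
        have "- ?B \<subseteq> {x. t - dist x0 y \<le> norm (x - y)}"
        proof
          fix x assume "x \<in> - ?B"
          then show "x \<in> {x. t - dist x0 y \<le> norm (x - y)}"
            using dist_triangle[of x0 x y] by (auto simp: dist_norm norm_minus_commute)
        qed
        then have "(\<integral>\<^sup>+x. T y x \<partial>lebesgue)
            \<le> (\<integral>\<^sup>+x\<in>{x. t - dist x0 y \<le> norm (x - y)}. ennreal (frac_kernel \<sigma> x y) \<partial>lebesgue)"
          unfolding T_def using True by (intro nn_integral_mono) (auto simp: indicator_def)
        also have "\<dots> \<le> ennreal (K * (t - dist x0 y) powr - \<sigma>)"
          unfolding K_def by (rule frac_kernel_tail[OF \<sigma> d])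
        finally show ?thesis using True K0 by (simp add: ennreal_mult)
      qed (simp add: T_def)
    qed
    also have "\<dots> = ennreal K * I" unfolding I_def by (rule nn_integral_cmult[OF Im])
    finally show ?thesis .
  qed
  have "(\<integral>\<^sup>+y. (\<integral>\<^sup>+x. energy_weight \<Omega> y x * (ennreal (2 powr (p + 1)) * (T y x + T x y)) \<partial>lebesgue) \<partial>lebesgue)
      \<le> (\<integral>\<^sup>+y. (\<integral>\<^sup>+x. ennreal (2 powr (p + 1)) * T y x + ennreal (2 powr (p + 1)) * T x y \<partial>lebesgue) \<partial>lebesgue)"
  proof (intro nn_integral_mono)
    fix y x
    have "energy_weight \<Omega> y x * (ennreal (2 powr (p + 1)) * (T y x + T x y))
        \<le> 1 * (ennreal (2 powr (p + 1)) * (T y x + T x y))"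
      by (intro mult_right_mono energy_weight_le_1) auto
    then show "energy_weight \<Omega> y x * (ennreal (2 powr (p + 1)) * (T y x + T x y))
        \<le> ennreal (2 powr (p + 1)) * T y x + ennreal (2 powr (p + 1)) * T x y"
      by (simp add: distrib_left)
  qed
  also have "\<dots> = (\<integral>\<^sup>+y. (\<integral>\<^sup>+x. ennreal (2 powr (p + 1)) * T y x \<partial>lebesgue) \<partial>lebesgue)
      + (\<integral>\<^sup>+y. (\<integral>\<^sup>+x. ennreal (2 powr (p + 1)) * T x y \<partial>lebesgue) \<partial>lebesgue)"
    by (rule nn_integral_iterated_add[OF cTm cTm'])
  also have "(\<integral>\<^sup>+y. (\<integral>\<^sup>+x. ennreal (2 powr (p + 1)) * T x y \<partial>lebesgue) \<partial>lebesgue)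
      = (\<integral>\<^sup>+y. (\<integral>\<^sup>+x. ennreal (2 powr (p + 1)) * T y x \<partial>lebesgue) \<partial>lebesgue)"
    by (rule Fubini'[OF cTm])
  also have "(\<integral>\<^sup>+y. (\<integral>\<^sup>+x. ennreal (2 powr (p + 1)) * T y x \<partial>lebesgue) \<partial>lebesgue)
      = ennreal (2 powr (p + 1)) * (\<integral>\<^sup>+y. (\<integral>\<^sup>+x. T y x \<partial>lebesgue) \<partial>lebesgue)"
  proof -
    have m1: "T y \<in> borel_measurable lebesgue" for y
      using measurable_compose[OF measurable_Pair1' Tm, of y] by simp
    have m2: "(\<lambda>y. \<integral>\<^sup>+x. T y x \<partial>lebesgue) \<in> borel_measurable lebesgue"
      using sigma_finite_measure.borel_measurable_nn_integral[OF sigma_finite_lebesgue Tm] .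
    show ?thesis by (simp add: nn_integral_cmult m1 m2)
  qed
  also have "ennreal (2 powr (p + 1)) * (\<integral>\<^sup>+y. (\<integral>\<^sup>+x. T y x \<partial>lebesgue) \<partial>lebesgue)
      + ennreal (2 powr (p + 1)) * (\<integral>\<^sup>+y. (\<integral>\<^sup>+x. T y x \<partial>lebesgue) \<partial>lebesgue)
      \<le> ennreal (2 powr (p + 1)) * (ennreal K * I) + ennreal (2 powr (p + 1)) * (ennreal K * I)"
    by (intro add_mono mult_left_mono TI) auto
  also have "\<dots> = ennreal (loss_const ?n \<sigma> p) * I"
  proof -
    have l: "loss_const ?n \<sigma> p = 2 powr (p + 1) * K + 2 powr (p + 1) * K"
    proof -
      have "(2::real) powr (p + 2) = 2 powr ((p + 1) + 1)" by (simp add: add.assoc)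
      also have "\<dots> = 2 powr (p + 1) + 2 powr (p + 1)" unfolding powr_add[of 2 "p + 1" 1] by simp
      finally show ?thesis unfolding loss_const_def K_def by (simp only: distrib_right)
    qed
    show ?thesis unfolding l using K0
      by (subst ennreal_plus) (auto simp: distrib_right ennreal_mult mult.assoc)
  qed
  finally show ?thesis unfolding T_def I_def .
qed

text \<open>The pointwise inequality is multiplied by the weighted kernel and integrated. Gain and
  loss stand as summands on opposite sides, which avoids subtraction of possibly infinite
  energies.\<close>

lemma truncation_kinetic:
  fixes u :: "real ^ 'n \<Rightarrow> real"
  assumes p: "1 < p" and s: "0 < s"
    and u: "u \<in> borel_measurable lebesgue" "AE x in lebesgue. \<bar>u x\<bar> \<le> 1"
    and \<Omega>: "\<Omega> \<in> sets lebesgue" "ball x0 t \<subseteq> \<Omega>"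
    and l: "-1 \<le> l" "l \<le> b" "b \<le> b'" "l \<le> 1"
  defines "X \<equiv> \<lambda>c. {x \<in> ball x0 t. c < u x}"
    and "w \<equiv> (\<lambda>z. if z \<in> ball x0 t then min (u z) l else u z)"
  shows "kinetic_energy s p w \<Omega> + ennreal (gain_const CARD('n) (s * p) * (b' - b) powr p *
      measure lebesgue (X b') * measure lebesgue (X b) powr - (s * p / CARD('n)))
    \<le> kinetic_energy s p u \<Omega> + ennreal (loss_const CARD('n) (s * p) p) *
      (\<integral>\<^sup>+y\<in>X l. ennreal ((t - dist x0 y) powr - (s * p)) \<partial>lebesgue)"
proof -
  let ?B = "ball x0 t" and ?\<sigma> = "s * p"
  have \<sigma>: "0 < s * p" using p s by simp
  have Xs: "X c \<in> sets lebesgue" "X c \<subseteq> ball x0 t" for c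
    unfolding X_def using superlevel_lebesgue[OF u(1)] by auto
  have finX: "emeasure lebesgue (X c) < \<infinity>" for c
    using Xs(2) by (rule emeasure_lebesgue_finite_of_subset_ball)
  have Bs: "?B \<in> sets lebesgue" by simp
  have wm: "w \<in> borel_measurable lebesgue"
    unfolding w_def using u(1) Bs by measurable
  define G where "G y x = ennreal ((b' - b) powr p) *
     (indicator (X b') y * (ennreal (frac_kernel ?\<sigma> x y) * indicator (- X b) x))" for y x
  define L where "L y x = ennreal (2 powr (p + 1)) *
      (indicator (X l) y * (ennreal (frac_kernel ?\<sigma> x y) * indicator (- ?B) x)
        + indicator (X l) x * (ennreal (frac_kernel ?\<sigma> y x) * indicator (- ?B) y))" for y x
  note [measurable] = frac_kernel_measurable_pair[of ?\<sigma>] energy_weight_measurable[OF \<Omega>(1)]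
  have km: "(\<lambda>(y, x). energy_weight \<Omega> y x * ennreal (gagliardo_kernel s p v x y))
      \<in> borel_measurable (lebesgue \<Otimes>\<^sub>M lebesgue)" if [measurable]: "v \<in> borel_measurable lebesgue" for v
    unfolding gagliardo_kernel_eq by measurable
  have Gm: "(\<lambda>(y, x). energy_weight \<Omega> y x * G y x) \<in> borel_measurable (lebesgue \<Otimes>\<^sub>M lebesgue)"
    unfolding G_def using Xs by measurable
  have frac': "(\<lambda>(y, x). frac_kernel ?\<sigma> y x) \<in> borel_measurable (lebesgue \<Otimes>\<^sub>M (lebesgue :: (real ^ 'n) measure))"
    using frac_kernel_measurable_pair[of ?\<sigma>] by (simp add: frac_kernel_commute[of _ "fst _"] case_prod_beta')
  have Lm: "(\<lambda>(y, x). energy_weight \<Omega> y x * L y x) \<in> borel_measurable (lebesgue \<Otimes>\<^sub>M lebesgue)"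
    unfolding L_def using Xs Bs frac' by measurable
  have pw: "energy_weight \<Omega> y x * ennreal (gagliardo_kernel s p w x y) + energy_weight \<Omega> y x * G y x
      \<le> energy_weight \<Omega> y x * ennreal (gagliardo_kernel s p u x y) + energy_weight \<Omega> y x * L y x"
    if ux: "\<bar>u x\<bar> \<le> 1" and uy: "\<bar>u y\<bar> \<le> 1" for x y
  proof -
    define k where "k = frac_kernel ?\<sigma> x y"
    have k: "0 \<le> k" "frac_kernel ?\<sigma> y x = k" by (auto simp: k_def frac_kernel_commute)
    define o1 :: real where "o1 = of_bool (y \<in> ?B \<and> b' < u y \<and> \<not> (x \<in> ?B \<and> b < u x))"
    define o2 :: real where "o2 = of_bool (y \<in> ?B \<and> l < u y \<and> x \<notin> ?B) + of_bool (x \<in> ?B \<and> l < u x \<and> y \<notin> ?B)"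
    have o: "0 \<le> o1" "0 \<le> o2" by (auto simp: o1_def o2_def)
    have "\<bar>w x - w y\<bar> powr p + (b' - b) powr p * o1 \<le> \<bar>u x - u y\<bar> powr p + 2 powr (p + 1) * o2"
      unfolding w_def o1_def o2_def using p l ux uy by (intro truncation_pointwise) auto
    then have "(\<bar>w x - w y\<bar> powr p + (b' - b) powr p * o1) * k \<le> (\<bar>u x - u y\<bar> powr p + 2 powr (p + 1) * o2) * k"
      using k by (intro mult_right_mono) auto
    then have "ennreal (gagliardo_kernel s p w x y + (b' - b) powr p * o1 * k)
        \<le> ennreal (gagliardo_kernel s p u x y + 2 powr (p + 1) * o2 * k)"
      unfolding gagliardo_kernel_eq k_def[symmetric] by (intro ennreal_leI) (simp add: algebra_simps)
    moreover have "G y x = ennreal ((b' - b) powr p * o1 * k)"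
      unfolding G_def k_def[symmetric] o1_def X_def using k
      by (auto simp: indicator_def ennreal_mult)
    moreover have "L y x = ennreal (2 powr (p + 1) * o2 * k)"
      unfolding L_def k(2) k_def[symmetric] o2_def X_def using k
      by (auto simp: indicator_def ennreal_mult)
    moreover have "0 \<le> gagliardo_kernel s p v x y" for v :: "real ^ 'n \<Rightarrow> real"
      by (simp add: gagliardo_kernel_eq)
    ultimately have "ennreal (gagliardo_kernel s p w x y) + G y x \<le> ennreal (gagliardo_kernel s p u x y) + L y x"
      using o k by (simp add: ennreal_plus)
    then show ?thesis
      unfolding distrib_left[symmetric] by (rule mult_left_mono) simp
  qed
  have "kinetic_energy s p w \<Omega> + (\<integral>\<^sup>+y. (\<integral>\<^sup>+x. energy_weight \<Omega> y x * G y x \<partial>lebesgue) \<partial>lebesgue)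
    = (\<integral>\<^sup>+y. (\<integral>\<^sup>+x. energy_weight \<Omega> y x * ennreal (gagliardo_kernel s p w x y)
         + energy_weight \<Omega> y x * G y x \<partial>lebesgue) \<partial>lebesgue)"
    unfolding kinetic_energy_eq[OF wm \<Omega>(1)] by (rule nn_integral_iterated_add[OF km[OF wm] Gm, symmetric])
  also have "\<dots> \<le> (\<integral>\<^sup>+y. (\<integral>\<^sup>+x. energy_weight \<Omega> y x * ennreal (gagliardo_kernel s p u x y)
         + energy_weight \<Omega> y x * L y x \<partial>lebesgue) \<partial>lebesgue)"
  proof (rule nn_integral_mono_AE, use u(2) in eventually_elim)
    case y: (elim y)
    show ?case
      by (rule nn_integral_mono_AE, use u(2) in eventually_elim) (rule pw, use y in auto)
  qed
  also have "\<dots> = kinetic_energy s p u \<Omega> + (\<integral>\<^sup>+y. (\<integral>\<^sup>+x. energy_weight \<Omega> y x * L y x \<partial>lebesgue) \<partial>lebesgue)"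
    unfolding kinetic_energy_eq[OF u(1) \<Omega>(1)] by (rule nn_integral_iterated_add[OF km[OF u(1)] Lm])
  finally have main: "kinetic_energy s p w \<Omega> + (\<integral>\<^sup>+y. (\<integral>\<^sup>+x. energy_weight \<Omega> y x * G y x \<partial>lebesgue) \<partial>lebesgue)
    \<le> kinetic_energy s p u \<Omega> + (\<integral>\<^sup>+y. (\<integral>\<^sup>+x. energy_weight \<Omega> y x * L y x \<partial>lebesgue) \<partial>lebesgue)" .
  have g: "ennreal (gain_const CARD('n) ?\<sigma> * (b' - b) powr p * measure lebesgue (X b') * measure lebesgue (X b) powr - (?\<sigma> / CARD('n)))
     \<le> (\<integral>\<^sup>+y. (\<integral>\<^sup>+x. energy_weight \<Omega> y x * G y x \<partial>lebesgue) \<partial>lebesgue)"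
    unfolding G_def
  proof (rule kinetic_gain[OF \<sigma> Xs(1) finX Xs(1)])
    show "X b' \<subseteq> X b" using l by (auto simp: X_def)
    show "X b' \<subseteq> \<Omega>" using Xs(2) \<Omega>(2) by blast
  qed simp
  have l: "(\<integral>\<^sup>+y. (\<integral>\<^sup>+x. energy_weight \<Omega> y x * L y x \<partial>lebesgue) \<partial>lebesgue)
     \<le> ennreal (loss_const CARD('n) ?\<sigma> p) * (\<integral>\<^sup>+y\<in>X l. ennreal ((t - dist x0 y) powr - ?\<sigma>) \<partial>lebesgue)"
    unfolding L_def by (rule kinetic_loss[OF \<sigma> Xs])
  show ?thesis
    by (rule order_trans[OF add_left_mono[OF g] order_trans[OF main add_left_mono[OF l]]])
qed

text \<open>Minimality is tested against the truncation \<open>w\<close>. The kinetic energy of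
  \<open>w\<close> and the potential energy outside \<open>X l\<close> occur on both sides and
  cancel; the kinetic change comes from \<open>truncation_kinetic\<close>, and on \<open>X l\<close>
  the potential of \<open>w\<close> is the constant \<open>W l\<close>.\<close>

lemma truncation_energy:
  fixes u :: "real ^ 'n \<Rightarrow> real"
  assumes p: "1 < p" and s: "0 < s"
    and min: "minimizer_bounded s p W \<epsilon> \<Omega> u"
    and \<Omega>: "\<Omega> \<in> sets lebesgue" "bounded \<Omega>" "ball x0 t \<subseteq> \<Omega>"
    and W: "continuous_on {-1..1} W" "\<And>x. x \<in> {-1..1} \<Longrightarrow> 0 \<le> W x"
    and l: "-1 \<le> l" "l \<le> b" "b \<le> b'" "l \<le> 1"
  defines "X \<equiv> \<lambda>c. {x \<in> ball x0 t. c < u x}"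
  shows "ennreal (gain_const CARD('n) (s * p) * (b' - b) powr p *
      measure lebesgue (X b') * measure lebesgue (X b) powr - (s * p / CARD('n)))
     + ennreal (\<epsilon> powr - (s * p)) * (\<integral>\<^sup>+x\<in>X l. ennreal (W (u x)) \<partial>lebesgue)
    \<le> ennreal (\<epsilon> powr - (s * p)) * (ennreal (W l) * emeasure lebesgue (X l))
     + ennreal (loss_const CARD('n) (s * p) p) *
      (\<integral>\<^sup>+y\<in>X l. ennreal ((t - dist x0 y) powr - (s * p)) \<partial>lebesgue)"
    (is "?G + ?e * _ \<le> ?e * _ + ?L")
\<comment> \<open>An infinite loss leaves nothing to prove. A finite one bounds the kinetic energy
  of the truncation, which thereby becomes an admissible competitor.\<close>
proof (cases "?L = top")
  case True
  show ?thesis unfolding True by simp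
next
  case False
  then have fin: "?L < \<infinity>" by (simp only: less_top infinity_ennreal_def)
  let ?B = "ball x0 t"
  define w where "w = (\<lambda>z. if z \<in> ?B then min (u z) l else u z)"
  have uX: "u \<in> Xsp s p \<Omega>" using min by (simp add: minimizer_bounded_def)
  note u = Xsp_D[OF uX]
  have Xs: "X l \<in> sets lebesgue" unfolding X_def by (rule superlevel_lebesgue[OF u(1)])
  have Bs: "?B \<in> sets lebesgue" by simp
  have wm: "w \<in> borel_measurable lebesgue"
    unfolding w_def using u(1) Bs by measurable
  have kin: "kinetic_energy s p w \<Omega> + ?G \<le> kinetic_energy s p u \<Omega> + ?L"
    unfolding w_def X_def by (rule truncation_kinetic[OF p s u(1) u(3) \<Omega>(1) \<Omega>(3) l])
  also have "\<dots> < \<infinity>" using u(2) fin by simp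
  finally have wfin: "kinetic_energy s p w \<Omega> < \<infinity>" by simp
  have w1: "AE x in lebesgue. \<bar>w x\<bar> \<le> 1"
    using u(3) by eventually_elim (use l in \<open>auto simp: w_def\<close>)
  have "esssup lebesgue (\<lambda>x. ereal \<bar>w x\<bar>) \<le> 1"
  proof (rule esssup_I)
    show "(\<lambda>x. ereal \<bar>w x\<bar>) \<in> borel_measurable lebesgue" using wm by measurable
    show "AE x in lebesgue. ereal \<bar>w x\<bar> \<le> 1" using w1 by eventually_elim simp
  qed
  then have wX: "w \<in> Xsp s p \<Omega>" using wm wfin by (simp add: Xsp_def)
  have "\<forall>x. x \<notin> \<Omega> \<longrightarrow> w x = u x" using \<Omega>(3) by (auto simp: w_def)
  then have minw: "total_energy s p W \<epsilon> u \<Omega> \<le> total_energy s p W \<epsilon> w \<Omega>"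
    using min wX unfolding minimizer_bounded_def by blast
  \<comment> \<open>Continuity of \<open>W\<close> is known only on [-1,1]. Clamping the argument
    gives a continuous function on the line that agrees with \<open>W\<close> along \<open>u\<close>
    almost everywhere.\<close>
  define Wc where "Wc x = W (max (-1) (min 1 x))" for x
  have "continuous_on UNIV Wc"
    unfolding Wc_def by (intro continuous_on_compose2[OF W(1)] continuous_intros) auto
  then have [measurable]: "Wc \<in> borel_measurable borel"
    by (rule borel_measurable_continuous_onI)
  have Wc: "Wc x = W x" if "\<bar>x\<bar> \<le> 1" for x
  proof -
    have "max (-1) (min 1 x) = x" using that by auto
    then show ?thesis by (simp add: Wc_def)
  qed
  define R where "R = (\<integral>\<^sup>+x. ennreal (Wc (u x)) * indicator (\<Omega> - X l) x \<partial>lebesgue)"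
  have Wum: "(\<lambda>x. ennreal (Wc (u x))) \<in> borel_measurable lebesgue" using u(1) by measurable
  have Pu: "(\<integral>\<^sup>+x\<in>\<Omega>. ennreal (W (u x)) \<partial>lebesgue) = R + (\<integral>\<^sup>+x\<in>X l. ennreal (W (u x)) \<partial>lebesgue)"
  proof -
    have "(\<integral>\<^sup>+x\<in>\<Omega>. ennreal (W (u x)) \<partial>lebesgue)
        = (\<integral>\<^sup>+x. ennreal (Wc (u x)) * indicator (\<Omega> - X l) x + ennreal (Wc (u x)) * indicator (X l) x \<partial>lebesgue)"
      by (rule nn_integral_cong_AE, use u(3) in eventually_elim)
         (use \<Omega>(3) in \<open>auto simp: Wc X_def indicator_def\<close>)
    also have "\<dots> = R + (\<integral>\<^sup>+x. ennreal (Wc (u x)) * indicator (X l) x \<partial>lebesgue)"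
      unfolding R_def by (intro nn_integral_add borel_measurable_times_ennreal Wum borel_measurable_const
        borel_measurable_indicator sets.Diff Xs \<Omega>(1))
    also have "(\<integral>\<^sup>+x. ennreal (Wc (u x)) * indicator (X l) x \<partial>lebesgue) = (\<integral>\<^sup>+x\<in>X l. ennreal (W (u x)) \<partial>lebesgue)"
      by (rule nn_integral_cong_AE, use u(3) in eventually_elim) (simp add: Wc)
    finally show ?thesis .
  qed
  have Pw: "(\<integral>\<^sup>+x\<in>\<Omega>. ennreal (W (w x)) \<partial>lebesgue) = R + ennreal (W l) * emeasure lebesgue (X l)"
  proof -
    have "(\<integral>\<^sup>+x\<in>\<Omega>. ennreal (W (w x)) \<partial>lebesgue)
        = (\<integral>\<^sup>+x. ennreal (Wc (u x)) * indicator (\<Omega> - X l) x + ennreal (W l) * indicator (X l) x \<partial>lebesgue)"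
      by (rule nn_integral_cong_AE, use u(3) in eventually_elim)
         (use \<Omega>(3) in \<open>auto simp: Wc X_def indicator_def w_def min_def\<close>)
    also have "\<dots> = R + (\<integral>\<^sup>+x. ennreal (W l) * indicator (X l) x \<partial>lebesgue)"
      unfolding R_def by (intro nn_integral_add borel_measurable_times_ennreal Wum borel_measurable_const
        borel_measurable_indicator sets.Diff Xs \<Omega>(1))
    finally show ?thesis using Xs by (simp add: nn_integral_cmult_indicator)
  qed
  \<comment> \<open>Cancellation in \<open>ennreal\<close> requires a finite summand; boundedness of
    \<Omega> enters here.\<close>
  have Rfin: "R < \<infinity>"
  proof -
    have "compact (W ` {-1..1})" by (intro compact_continuous_image W(1)) simp
    then have "bounded (W ` {-1..1})" by (rule compact_imp_bounded)
    then obtain M where "\<forall>y\<in>W ` {-1..1}. norm y \<le> M" unfolding bounded_iff by blast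
    then have M: "\<bar>W x\<bar> \<le> M" if "x \<in> {-1..1}" for x using that by auto
    obtain r where "\<Omega> \<subseteq> ball 0 r" using bounded_subset_ballD[OF \<Omega>(2)] by blast
    then have fO: "emeasure lebesgue \<Omega> < \<infinity>" by (rule emeasure_lebesgue_finite_of_subset_ball)
    have "Wc x \<le> M" for x
      using M[of "max (-1) (min 1 x)"] unfolding Wc_def by (auto simp: abs_le_iff)
    then have "R \<le> (\<integral>\<^sup>+x. ennreal M * indicator \<Omega> x \<partial>lebesgue)"
      unfolding R_def by (intro nn_integral_mono) (auto simp: indicator_def intro!: ennreal_leI)
    also have "\<dots> = ennreal M * emeasure lebesgue \<Omega>" using \<Omega>(1) by (rule nn_integral_cmult_indicator)
    also have "\<dots> < \<infinity>" using fO by (simp add: ennreal_mult_less_top)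
    finally show ?thesis .
  qed
  define F where "F = kinetic_energy s p w \<Omega> + ?e * R"
  have "F < \<infinity>" unfolding F_def using wfin Rfin by (simp add: ennreal_mult_less_top)
  have "F + (?G + ?e * (\<integral>\<^sup>+x\<in>X l. ennreal (W (u x)) \<partial>lebesgue))
      = (kinetic_energy s p w \<Omega> + ?G) + ?e * (\<integral>\<^sup>+x\<in>\<Omega>. ennreal (W (u x)) \<partial>lebesgue)"
    unfolding F_def Pu by (simp add: distrib_left ac_simps)
  also have "\<dots> \<le> (kinetic_energy s p u \<Omega> + ?L) + ?e * (\<integral>\<^sup>+x\<in>\<Omega>. ennreal (W (u x)) \<partial>lebesgue)"
    by (intro add_mono kin) auto
  also have "\<dots> = total_energy s p W \<epsilon> u \<Omega> + ?L" unfolding total_energy_def by (simp add: ac_simps)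
  also have "\<dots> \<le> total_energy s p W \<epsilon> w \<Omega> + ?L" by (intro add_mono minw) auto
  also have "\<dots> = F + (?e * (ennreal (W l) * emeasure lebesgue (X l)) + ?L)"
    unfolding total_energy_def Pw F_def by (simp add: distrib_left ac_simps)
  finally show ?thesis
    using \<open>F < \<infinity>\<close> by (subst (asm) ennreal_add_left_cancel_le) auto
qed

section \<open>Decay of superlevel sets\<close>

definition superlevel_vol :: "(real ^ 'n \<Rightarrow> real) \<Rightarrow> real ^ 'n \<Rightarrow> real \<Rightarrow> real \<Rightarrow> real" where
  "superlevel_vol u x0 c t = measure lebesgue {x \<in> ball x0 t. c < u x}"

lemma superlevel_vol_nonneg [simp]: "0 \<le> superlevel_vol u x0 c t"
  by (simp add: superlevel_vol_def)

lemma emeasure_superlevel: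
  "emeasure lebesgue {x \<in> ball x0 t. c < u x} = ennreal (superlevel_vol u x0 c t)"
proof -
  have "{x \<in> ball x0 t. c < u x} \<subseteq> ball x0 t" by auto
  from emeasure_lebesgue_finite_of_subset_ball[OF this] show ?thesis
    unfolding superlevel_vol_def infinity_ennreal_def less_top[symmetric]
    by (rule emeasure_eq_ennreal_measure)
qed

lemma superlevel_vol_mono:
  assumes "u \<in> borel_measurable lebesgue" "c' \<le> c" "t \<le> t'"
  shows "superlevel_vol u x0 c t \<le> superlevel_vol u x0 c' t'"
proof -
  have "emeasure lebesgue {x \<in> ball x0 t. c < u x} \<le> emeasure lebesgue {x \<in> ball x0 t'. c' < u x}"
    using assms by (intro emeasure_mono superlevel_lebesgue) auto
  then show ?thesis unfolding emeasure_superlevel by (subst (asm) ennreal_le_iff) auto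
qed

lemma superlevel_vol_le_ball:
  fixes u :: "real ^ 'n \<Rightarrow> real"
  assumes "0 \<le> t"
  shows "superlevel_vol u x0 c t \<le> unit_ball_vol CARD('n) * t ^ CARD('n)"
proof -
  have "emeasure lebesgue {x \<in> ball x0 t. c < u x} \<le> emeasure lebesgue (ball x0 t)"
    by (intro emeasure_mono) auto
  then show ?thesis unfolding emeasure_superlevel emeasure_lebesgue_ball[OF assms]
    using assms by (subst (asm) ennreal_le_iff) auto
qed

section \<open>Decay of superlevel volumes in one truncation\<close>

definition step_const :: "nat \<Rightarrow> real \<Rightarrow> real \<Rightarrow> real" where
  "step_const n \<sigma> p = loss_const n \<sigma> p * (2 / (1 - \<sigma>))"

lemma step_const_pos: "0 < \<sigma> \<Longrightarrow> \<sigma> < 1 \<Longrightarrow> 0 < step_const n \<sigma> p"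
  by (simp add: step_const_def loss_const_pos)

text \<open>\<open>truncation_energy\<close> at the radius supplied by
  \<open>ex_radius_boundary_integral_le\<close>; \<open>step_const\<close> collects the factor 2/(1
  - \<sigma>) of the averaging. The radius is known only to lie between \<open>\<rho>'\<close> and
  \<open>\<rho>\<close>, so later estimates compare volumes at the two ends by monotonicity.\<close>

lemma truncation_step:
  fixes u :: "real ^ 'n \<Rightarrow> real"
  assumes p: "1 < p" and s: "0 < s" "s * p < 1"
    and min: "minimizer_bounded s p W \<epsilon> \<Omega> u"
    and \<Omega>: "\<Omega> \<in> sets lebesgue" "bounded \<Omega>" "ball x0 \<rho> \<subseteq> \<Omega>"
    and W: "continuous_on {-1..1} W" "\<And>x. x \<in> {-1..1} \<Longrightarrow> 0 \<le> W x"
    and l: "-1 \<le> l" "l \<le> b" "b \<le> b'" "l \<le> 1"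
    and \<rho>: "\<rho>' < \<rho>"
  shows "\<exists>t\<in>{\<rho>'<..<\<rho>}. ennreal (gain_const CARD('n) (s * p) * (b' - b) powr p *
      superlevel_vol u x0 b' t * superlevel_vol u x0 b t powr - (s * p / CARD('n)))
     + ennreal (\<epsilon> powr - (s * p)) * (\<integral>\<^sup>+x\<in>{x \<in> ball x0 t. l < u x}. ennreal (W (u x)) \<partial>lebesgue)
    \<le> ennreal (\<epsilon> powr - (s * p) * (W l * superlevel_vol u x0 l t)
     + step_const CARD('n) (s * p) p * (\<rho> - \<rho>') powr - (s * p) * superlevel_vol u x0 l \<rho>)"
proof -
  let ?\<sigma> = "s * p"
  let ?A = "{x \<in> ball x0 \<rho>. l < u x}"
  have \<sigma>: "0 < ?\<sigma>" using p s by simp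
  have um: "u \<in> borel_measurable lebesgue"
    using min Xsp_D(1) by (auto simp: minimizer_bounded_def)
  have As: "?A \<subseteq> ball x0 \<rho>" by auto
  obtain t where t: "t \<in> {\<rho>'<..<\<rho>}" and I: "(\<integral>\<^sup>+y\<in>?A \<inter> ball x0 t. ennreal ((t - dist x0 y) powr - ?\<sigma>) \<partial>lebesgue)
           \<le> ennreal (2 / (1 - ?\<sigma>) * (\<rho> - \<rho>') powr - ?\<sigma> * measure lebesgue ?A)"
    using ex_radius_boundary_integral_le[OF \<sigma> s(2) \<rho> superlevel_lebesgue[OF um, of x0 \<rho> l] As] by blast
  have At: "?A \<inter> ball x0 t = {x \<in> ball x0 t. l < u x}" using t by auto
  have bt: "ball x0 t \<subseteq> \<Omega>" using \<Omega>(3) t by (meson greaterThanLessThan_iff less_imp_le order_trans subset_ball)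
  have Wl: "0 \<le> W l" using W(2) l by auto
  have L0: "0 \<le> loss_const CARD('n) ?\<sigma> p" using loss_const_pos[OF \<sigma>] by (simp add: less_imp_le)
  have "ennreal (gain_const CARD('n) (s * p) * (b' - b) powr p *
      superlevel_vol u x0 b' t * superlevel_vol u x0 b t powr - (s * p / CARD('n)))
     + ennreal (\<epsilon> powr - (s * p)) * (\<integral>\<^sup>+x\<in>{x \<in> ball x0 t. l < u x}. ennreal (W (u x)) \<partial>lebesgue)
    \<le> ennreal (\<epsilon> powr - (s * p)) * (ennreal (W l) * emeasure lebesgue {x \<in> ball x0 t. l < u x})
     + ennreal (loss_const CARD('n) (s * p) p) *
      (\<integral>\<^sup>+y\<in>{x \<in> ball x0 t. l < u x}. ennreal ((t - dist x0 y) powr - (s * p)) \<partial>lebesgue)"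
    unfolding superlevel_vol_def using truncation_energy[OF p s(1) min \<Omega>(1,2) bt W l] by simp
  also have "\<dots> \<le> ennreal (\<epsilon> powr - (s * p)) * (ennreal (W l) * ennreal (superlevel_vol u x0 l t))
     + ennreal (loss_const CARD('n) (s * p) p) *
        ennreal (2 / (1 - ?\<sigma>) * (\<rho> - \<rho>') powr - ?\<sigma> * superlevel_vol u x0 l \<rho>)"
    unfolding emeasure_superlevel using I unfolding At superlevel_vol_def[symmetric]
    by (intro add_left_mono mult_left_mono) auto
  also have "\<dots> = ennreal (\<epsilon> powr - (s * p) * (W l * superlevel_vol u x0 l t)
     + step_const CARD('n) (s * p) p * (\<rho> - \<rho>') powr - (s * p) * superlevel_vol u x0 l \<rho>)"
  proof -
    define R where "R = 2 / (1 - ?\<sigma>) * (\<rho> - \<rho>') powr - ?\<sigma> * superlevel_vol u x0 l \<rho>"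
    have R: "0 \<le> R" unfolding R_def using s by simp
    have "step_const CARD('n) (s * p) p * (\<rho> - \<rho>') powr - (s * p) * superlevel_vol u x0 l \<rho>
        = loss_const CARD('n) ?\<sigma> p * R" unfolding step_const_def R_def by simp
    then show ?thesis
      unfolding R_def[symmetric] using Wl L0 R by (simp add: ennreal_mult ennreal_plus)
  qed
  finally show ?thesis using t by blast
qed

text \<open>Negative powers decrease, except that \<open>0 powr\<close> gives 0; when
  \<open>S = 0\<close> the factor \<open>X\<close> vanishes as well.\<close>

lemma powr_neg_superlevel_mono:
  assumes "0 \<le> \<beta>" "0 \<le> X" "X \<le> S" "S \<le> Q" "0 \<le> (c::real)"
  shows "c * X * Q powr - \<beta> \<le> c * X * S powr - \<beta>"
proof (cases "S = 0")
  case False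
  then have "Q powr - \<beta> \<le> S powr - \<beta>" using assms by (intro powr_mono2') auto
  then show ?thesis using assms by (intro mult_left_mono) auto
qed (use assms in auto)

text \<open>The De Giorgi step: truncation at \<open>l\<close> with \<open>b = l\<close> and
  \<open>b' = l'\<close>, where the potential on the left is discarded and only the kinetic gain is
  kept. Moving the negative power of the volume to the right yields the superlinear
  exponent.\<close>

lemma superlevel_decay_nonlinear:
  fixes u :: "real ^ 'n \<Rightarrow> real"
  assumes p: "1 < p" and s: "0 < s" "s * p < 1"
    and min: "minimizer_bounded s p W \<epsilon> \<Omega> u"
    and \<Omega>: "\<Omega> \<in> sets lebesgue" "bounded \<Omega>" "ball x0 \<rho> \<subseteq> \<Omega>"
    and W: "continuous_on {-1..1} W" "\<And>x. x \<in> {-1..1} \<Longrightarrow> 0 \<le> W x"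
    and l: "-1 \<le> l" "l < l'" "l \<le> 1" and \<rho>: "\<rho>' < \<rho>" and M: "W l \<le> M"
  shows "gain_const CARD('n) (s * p) * (l' - l) powr p * superlevel_vol u x0 l' \<rho>'
    \<le> (step_const CARD('n) (s * p) p * (\<rho> - \<rho>') powr - (s * p) + \<epsilon> powr - (s * p) * M)
       * superlevel_vol u x0 l \<rho> powr (1 + s * p / CARD('n))"
proof -
  let ?\<beta> = "s * p / CARD('n)"
  let ?V = "superlevel_vol u x0"
  define g where "g = gain_const CARD('n) (s * p) * (l' - l) powr p"
  define C where "C = step_const CARD('n) (s * p) p * (\<rho> - \<rho>') powr - (s * p)"
  define e where "e = \<epsilon> powr - (s * p)"
  have \<sigma>: "0 < s * p" using p s by simp
  have \<beta>: "0 \<le> ?\<beta>" using \<sigma> by simp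
  have g: "0 \<le> g" unfolding g_def using gain_const_pos by (simp add: less_imp_le)
  have C: "0 \<le> C" unfolding C_def using step_const_pos[OF \<sigma> s(2)] by (simp add: less_imp_le)
  have e: "0 \<le> e" unfolding e_def by simp
  have um: "u \<in> borel_measurable lebesgue"
    using min Xsp_D(1) by (auto simp: minimizer_bounded_def)
  have Wl: "0 \<le> W l" using W(2) l by auto
  obtain t where t: "t \<in> {\<rho>'<..<\<rho>}" and st: "ennreal (g * ?V l' t * ?V l t powr - ?\<beta>)
       + ennreal e * (\<integral>\<^sup>+x\<in>{x \<in> ball x0 t. l < u x}. ennreal (W (u x)) \<partial>lebesgue)
      \<le> ennreal (e * (W l * ?V l t) + C * ?V l \<rho>)"
    using truncation_step[OF p s min \<Omega> W l(1) order_refl _ l(3) \<rho>, of l'] l(2)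
    unfolding g_def C_def e_def by auto
  have "ennreal (g * ?V l' t * ?V l t powr - ?\<beta>) \<le> ennreal (e * (W l * ?V l t) + C * ?V l \<rho>)"
    using st by (rule order_trans[rotated]) simp
  then have "g * ?V l' t * ?V l t powr - ?\<beta> \<le> e * (W l * ?V l t) + C * ?V l \<rho>"
    using e Wl C by (subst (asm) ennreal_le_iff) auto
  also have "\<dots> \<le> e * (M * ?V l \<rho>) + C * ?V l \<rho>"
    using t M e Wl by (intro add_right_mono mult_left_mono mult_mono superlevel_vol_mono um) auto
  finally have 1: "g * ?V l' t * ?V l t powr - ?\<beta> \<le> (C + e * M) * ?V l \<rho>" by (simp add: algebra_simps)
  have mono: "?V l' t \<le> ?V l t" "?V l t \<le> ?V l \<rho>" "?V l' \<rho>' \<le> ?V l' t"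
    using t l by (auto intro!: superlevel_vol_mono um)
  have "g * ?V l' \<rho>' * ?V l \<rho> powr - ?\<beta> \<le> g * ?V l' t * ?V l \<rho> powr - ?\<beta>"
    using g mono by (intro mult_right_mono mult_left_mono) auto
  also have "\<dots> \<le> g * ?V l' t * ?V l t powr - ?\<beta>"
    using \<beta> g mono by (intro powr_neg_superlevel_mono) auto
  finally have 2: "g * ?V l' \<rho>' * ?V l \<rho> powr - ?\<beta> \<le> (C + e * M) * ?V l \<rho>" using 1 by linarith
  show ?thesis
  proof (cases "?V l \<rho> = 0")
    case True
    then have "?V l' \<rho>' = 0" using mono superlevel_vol_nonneg[of u x0 l' \<rho>'] by linarith
    then show ?thesis using True by simp
  next
    case False
    then have pos: "0 < ?V l \<rho>" using superlevel_vol_nonneg[of u x0 l \<rho>] by linarith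
    have "g * ?V l' \<rho>' = g * ?V l' \<rho>' * ?V l \<rho> powr - ?\<beta> * ?V l \<rho> powr ?\<beta>"
      using pos by (simp add: powr_minus)
    also have "\<dots> \<le> (C + e * M) * ?V l \<rho> * ?V l \<rho> powr ?\<beta>"
      using 2 by (intro mult_right_mono) auto
    also have "\<dots> = (C + e * M) * ?V l \<rho> powr (1 + ?\<beta>)"
      using pos by (simp add: powr_add)
    finally show ?thesis unfolding g_def C_def e_def .
  qed
qed

lemma AE_eq_measurable_potential:
  assumes "u \<in> borel_measurable M" "AE x in M. \<bar>u x\<bar> \<le> 1" and W: "continuous_on {-1..1::real} W"
  shows "\<exists>f\<in>borel_measurable M. AE x in M. ennreal (W (u x)) = f x"
proof
  define Wc where "Wc x = W (max (-1) (min 1 x))" for x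
  have "continuous_on UNIV Wc"
    unfolding Wc_def by (intro continuous_on_compose2[OF W] continuous_intros) auto
  then have [measurable]: "Wc \<in> borel_measurable borel"
    by (rule borel_measurable_continuous_onI)
  show "(\<lambda>x. ennreal (Wc (u x))) \<in> borel_measurable M" using assms(1) by measurable
  have "max (-1) (min 1 x) = x" if "\<bar>x\<bar> \<le> 1" for x :: real using that by auto
  then show "AE x in M. ennreal (W (u x)) = ennreal (Wc (u x))"
    using assms(2) by (auto simp: Wc_def elim!: eventually_mono)
qed

text \<open>Here the potential does the work: on \<open>l' < u \<le> 0\<close> truncation saves at
  least \<open>g\<close> per unit volume. On \<open>u > 0\<close> it may cost potential energy, as
  \<open>W\<close> can be small near the other well; this is absorbed by the kinetic gain between
  the levels -1/2 and 0, which is large because the set above -1/2 has volume at most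
  \<open>Q\<close>.\<close>

lemma superlevel_decay_linear:
  fixes u :: "real ^ 'n \<Rightarrow> real"
  assumes p: "1 < p" and s: "0 < s" "s * p < 1" and \<epsilon>: "0 < \<epsilon>"
    and min: "minimizer_bounded s p W \<epsilon> \<Omega> u"
    and \<Omega>: "\<Omega> \<in> sets lebesgue" "bounded \<Omega>" "ball x0 \<rho> \<subseteq> \<Omega>"
    and W: "continuous_on {-1..1} W" "\<And>x. x \<in> {-1..1} \<Longrightarrow> 0 \<le> W x"
    and l: "-1 \<le> l" "l \<le> l'" "l' \<le> -1/2" and \<rho>: "\<rho>' < \<rho>"
    and g: "0 < g" "W l \<le> g"
    and Wl: "\<And>x. l < x \<Longrightarrow> x \<le> 0 \<Longrightarrow> W l \<le> W x"
    and Wl': "\<And>x. l' < x \<Longrightarrow> x \<le> 0 \<Longrightarrow> W l + g \<le> W x"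
    and Q: "superlevel_vol u x0 (-1/2) \<rho> \<le> Q"
      "2 * (\<epsilon> powr - (s * p) * g) \<le> gain_const CARD('n) (s * p) * (1/2) powr p * Q powr - (s * p / CARD('n))"
  shows "\<epsilon> powr - (s * p) * g * superlevel_vol u x0 l' \<rho>'
    \<le> step_const CARD('n) (s * p) p * (\<rho> - \<rho>') powr - (s * p) * superlevel_vol u x0 l \<rho>"
proof -
  let ?\<beta> = "s * p / CARD('n)"
  let ?V = "superlevel_vol u x0"
  define c where "c = gain_const CARD('n) (s * p) * (1/2) powr p"
  define C where "C = step_const CARD('n) (s * p) p * (\<rho> - \<rho>') powr - (s * p)"
  define e where "e = \<epsilon> powr - (s * p)"
  have \<sigma>: "0 < s * p" using p s by simp
  have \<beta>: "0 \<le> ?\<beta>" using \<sigma> by simp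
  have c: "0 \<le> c" unfolding c_def using gain_const_pos by (simp add: less_imp_le)
  have C: "0 \<le> C" unfolding C_def using step_const_pos[OF \<sigma> s(2)] by (simp add: less_imp_le)
  have e: "0 \<le> e" unfolding e_def by simp
  have uX: "u \<in> Xsp s p \<Omega>" using min by (simp add: minimizer_bounded_def)
  note um = Xsp_D(1)[OF uX] and u1 = Xsp_D(3)[OF uX]
  have Wl0: "0 \<le> W l" using W(2) l by auto
  obtain t where t: "t \<in> {\<rho>'<..<\<rho>}" and st: "ennreal (c * ?V 0 t * ?V (-1/2) t powr - ?\<beta>)
       + ennreal e * (\<integral>\<^sup>+x\<in>{x \<in> ball x0 t. l < u x}. ennreal (W (u x)) \<partial>lebesgue)
      \<le> ennreal (e * (W l * ?V l t) + C * ?V l \<rho>)"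
    using truncation_step[OF p s min \<Omega> W l(1), of "-1/2" 0 \<rho>'] l \<rho>
    unfolding c_def C_def e_def by auto
  let ?I = "\<integral>\<^sup>+x\<in>{x \<in> ball x0 t. l < u x}. ennreal (W (u x)) \<partial>lebesgue"
  have sets: "{x \<in> ball x0 t. c < u x} \<in> sets lebesgue" for c by (rule superlevel_lebesgue[OF um])
  have mono: "?V 0 t \<le> ?V l' t" "?V 0 t \<le> ?V (-1/2) t" "?V (-1/2) t \<le> ?V (-1/2) \<rho>" "?V l' \<rho>' \<le> ?V l' t"
    using t l by (auto intro!: superlevel_vol_mono um)
  \<comment> \<open>On \<open>u > 0\<close> nothing beyond nonnegativity of the integrand is used,
    so the full amount \<open>W l + g\<close> is added as a correction there.\<close>
  have "ennreal (W l * ?V l t + g * ?V l' t) \<le> ?I + ennreal ((W l + g) * ?V 0 t)"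
  proof -
    have "ennreal (W l * ?V l t + g * ?V l' t)
      = (\<integral>\<^sup>+x. ennreal (W l) * indicator {x \<in> ball x0 t. l < u x} x
           + ennreal g * indicator {x \<in> ball x0 t. l' < u x} x \<partial>lebesgue)"
    proof -
      have m: "(\<lambda>x. ennreal k * indicator {x \<in> ball x0 t. c < u x} x) \<in> borel_measurable lebesgue" for k c
        by (intro borel_measurable_times_ennreal borel_measurable_const borel_measurable_indicator sets)
      show ?thesis
        unfolding nn_integral_add[OF m m] nn_integral_cmult_indicator[OF sets] emeasure_superlevel
        using Wl0 g by (simp add: ennreal_mult ennreal_plus)
    qed
    also have "\<dots> \<le> (\<integral>\<^sup>+x. ennreal (W (u x)) * indicator {x \<in> ball x0 t. l < u x} x
           + ennreal (W l + g) * indicator {x \<in> ball x0 t. 0 < u x} x \<partial>lebesgue)"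
    proof (rule nn_integral_mono_AE, use u1 in eventually_elim)
      case (elim x)
      consider "x \<notin> ball x0 t \<or> u x \<le> l" | "x \<in> ball x0 t" "l < u x" "u x \<le> l'"
        | "x \<in> ball x0 t" "l' < u x" "u x \<le> 0" | "x \<in> ball x0 t" "0 < u x" by linarith
      then show ?case
      proof cases
        case 1
        then show ?thesis using l by auto
      next
        case 2
        then show ?thesis using Wl[of "u x"] l by (auto intro!: ennreal_leI)
      next
        case 3
        then have "ennreal (W l + g) \<le> ennreal (W (u x))" using Wl'[of "u x"] by (intro ennreal_leI) auto
        then show ?thesis using 3 l Wl0 g by (auto simp: ennreal_plus)
      next
        case 4
        then show ?thesis using l Wl0 g by (auto simp: ennreal_plus)
      qed
    qed
    also have "\<dots> = ?I + ennreal (W l + g) * ennreal (?V 0 t)"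
    proof -
      have m: "(\<lambda>x. ennreal (W l + g) * indicator {x \<in> ball x0 t. 0 < u x} x) \<in> borel_measurable lebesgue"
        by (intro borel_measurable_times_ennreal borel_measurable_const borel_measurable_indicator sets)
      \<comment> \<open>Additivity of the integral is applied to a measurable representative of the
        potential along \<open>u\<close>.\<close>
      obtain f where f: "f \<in> borel_measurable lebesgue" "AE x in lebesgue. ennreal (W (u x)) = f x"
        using AE_eq_measurable_potential[OF um u1 W(1)] by blast
      have fm: "(\<lambda>x. f x * indicator {x \<in> ball x0 t. l < u x} x) \<in> borel_measurable lebesgue"
        by (intro borel_measurable_times_ennreal f(1) borel_measurable_indicator sets)
      have "(\<integral>\<^sup>+x. ennreal (W (u x)) * indicator {x \<in> ball x0 t. l < u x} x
           + ennreal (W l + g) * indicator {x \<in> ball x0 t. 0 < u x} x \<partial>lebesgue)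
         = (\<integral>\<^sup>+x. f x * indicator {x \<in> ball x0 t. l < u x} x
           + ennreal (W l + g) * indicator {x \<in> ball x0 t. 0 < u x} x \<partial>lebesgue)"
        by (rule nn_integral_cong_AE, use f(2) in eventually_elim) simp
      also have "\<dots> = (\<integral>\<^sup>+x. f x * indicator {x \<in> ball x0 t. l < u x} x \<partial>lebesgue)
           + ennreal (W l + g) * ennreal (?V 0 t)"
        by (subst nn_integral_add[OF fm m], subst nn_integral_cmult_indicator[OF sets],
            subst emeasure_superlevel) (rule refl)
      also have "(\<integral>\<^sup>+x. f x * indicator {x \<in> ball x0 t. l < u x} x \<partial>lebesgue) = ?I"
        by (rule nn_integral_cong_AE, use f(2) in eventually_elim) simp
      finally show ?thesis .
    qed
    finally show ?thesis using Wl0 g by (simp add: ennreal_mult)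
  qed
  then have "ennreal e * ennreal (W l * ?V l t + g * ?V l' t) \<le> ennreal e * (?I + ennreal ((W l + g) * ?V 0 t))"
    by (rule mult_left_mono) simp
  then have "ennreal (c * ?V 0 t * ?V (-1/2) t powr - ?\<beta>) + ennreal (e * (W l * ?V l t + g * ?V l' t))
      \<le> (ennreal (c * ?V 0 t * ?V (-1/2) t powr - ?\<beta>) + ennreal e * ?I) + ennreal (e * ((W l + g) * ?V 0 t))"
    using e Wl0 g by (simp add: ennreal_mult distrib_left add.assoc add_left_mono)
  also have "\<dots> \<le> ennreal (e * (W l * ?V l t) + C * ?V l \<rho>) + ennreal (e * ((W l + g) * ?V 0 t))"
    by (rule add_right_mono[OF st])
  finally have "c * ?V 0 t * ?V (-1/2) t powr - ?\<beta> + e * (W l * ?V l t + g * ?V l' t)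
     \<le> e * (W l * ?V l t) + C * ?V l \<rho> + e * ((W l + g) * ?V 0 t)"
    using c e Wl0 g C
    by (subst (asm) ennreal_plus[symmetric], simp, simp, subst (asm) ennreal_plus[symmetric], simp, simp,
        subst (asm) ennreal_le_iff) auto
  \<comment> \<open>\<open>W l \<le> g\<close> bounds the correction by 2g, which is the source of
    the factor 2 in the hypothesis on \<open>Q\<close>.\<close>
  moreover have "e * ((W l + g) * ?V 0 t) \<le> e * (2 * g * ?V 0 t)"
    using e g by (intro mult_left_mono mult_right_mono) auto
  moreover have "e * (2 * g * ?V 0 t) \<le> c * ?V 0 t * ?V (-1/2) t powr - ?\<beta>"
  proof -
    have "e * (2 * g * ?V 0 t) = 2 * (e * g) * ?V 0 t" by simp
    also have "\<dots> \<le> c * Q powr - ?\<beta> * ?V 0 t"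
      using Q(2) unfolding c_def e_def by (intro mult_right_mono) auto
    also have "\<dots> = c * ?V 0 t * Q powr - ?\<beta>" by simp
    also have "\<dots> \<le> c * ?V 0 t * ?V (-1/2) t powr - ?\<beta>"
      using \<beta> c mono Q(1) by (intro powr_neg_superlevel_mono) auto
    finally show ?thesis .
  qed
  ultimately have "e * g * ?V l' t \<le> C * ?V l \<rho>" by (simp add: algebra_simps)
  moreover have "e * g * ?V l' \<rho>' \<le> e * g * ?V l' t" using e g mono by (intro mult_left_mono) auto
  ultimately show ?thesis unfolding e_def C_def by linarith
qed

section \<open>Iteration of the decay estimates\<close>

lemma superlinear_recursion_decay:
  fixes Z :: "nat \<Rightarrow> real"
  assumes \<beta>: "0 < \<beta>" and q: "1 < q" and D: "0 \<le> D" and Z: "\<And>i. 0 \<le> Z i"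
    and rec: "\<And>i. Z (Suc i) \<le> D * q ^ i * Z i powr (1 + \<beta>)"
    and small: "D * Z 0 powr \<beta> \<le> q powr (- 1 / \<beta>)"
  shows "Z i \<le> Z 0 * (q powr (- 1 / \<beta>)) ^ i"
proof (induction i)
  case (Suc i)
  \<comment> \<open>This ratio satisfies \<theta>^\<beta> = 1/q, so geometric decay of
    \<open>Z i\<close> exactly cancels the growing factor q^i. The smallness hypothesis then says
    that one step gains a factor \<theta>.\<close>
  define \<theta> where "\<theta> = q powr (- 1 / \<beta>)"
  have \<theta>: "0 < \<theta>" unfolding \<theta>_def using q by simp
  have "(\<theta> ^ i) powr \<beta> = q powr (- real i)"
    unfolding \<theta>_def using q \<beta> by (simp add: powr_realpow[symmetric] powr_powr del: powr_realpow)
  also have "\<dots> = inverse (q ^ i)" using q by (simp add: powr_minus powr_realpow)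
  finally have \<theta>i: "(\<theta> ^ i) powr \<beta> = inverse (q ^ i)" .
  have "Z i powr \<beta> \<le> (Z 0 * \<theta> ^ i) powr \<beta>"
    using Suc.IH Z \<beta> unfolding \<theta>_def by (intro powr_mono2) auto
  also have "\<dots> = Z 0 powr \<beta> * inverse (q ^ i)"
    using Z \<theta> by (simp add: powr_mult \<theta>i)
  finally have le: "Z i powr \<beta> \<le> Z 0 powr \<beta> * inverse (q ^ i)" .
  have "Z (Suc i) \<le> D * q ^ i * (Z i * Z i powr \<beta>)"
    using rec[of i] Z[of i] by (cases "Z i = 0") (auto simp: powr_add)
  also have "\<dots> \<le> D * q ^ i * (Z i * (Z 0 powr \<beta> * inverse (q ^ i)))"
    using D q Z le by (intro mult_left_mono) auto
  also have "\<dots> = (D * Z 0 powr \<beta>) * Z i" using q by simp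
  also have "\<dots> \<le> \<theta> * (Z 0 * \<theta> ^ i)"
    using small Suc.IH Z \<theta> unfolding \<theta>_def[symmetric] by (intro mult_mono) auto
  finally show ?case unfolding \<theta>_def by (simp add: mult_ac)
qed simp

text \<open>The level is a minimum point of \<open>W\<close> over \<open>[-1+a,0]\<close>; this replaces monotonicity of \<open>W\<close>
  near the well.\<close>

lemma ex_truncation_level:
  fixes W :: "real \<Rightarrow> real"
  assumes m: "1 \<le> m" and c: "0 < c2" "0 < c3"
    and W: "continuous_on {-1..1} W"
    and growth: "\<And>x. x \<in> {-1<..<1} \<Longrightarrow> c2 * (1 - x\<^sup>2) powr m \<le> W x \<and> W x \<le> c3 * (1 - x\<^sup>2) powr m"
    and a: "0 < a" "a \<le> 1"
  defines "K \<equiv> (2 powr (m + 1) * c3 / c2) powr (1 / m)" and "g \<equiv> 2 powr m * c3 * a powr m"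
  shows "\<exists>l. -1 + a \<le> l \<and> l \<le> 0 \<and> l \<le> -1 + K * a \<and> W l \<le> g \<and>
    (\<forall>x. l < x \<longrightarrow> x \<le> 0 \<longrightarrow> W l \<le> W x) \<and> (\<forall>x. -1 + K * a < x \<longrightarrow> x \<le> 0 \<longrightarrow> W l + g \<le> W x)"
proof -
  have K: "0 < K" unfolding K_def using c by simp
  \<comment> \<open>\<open>K\<close> is the factor for which the lower growth bound at distance
    \<open>K * a\<close> from the well is twice \<open>g\<close>, the upper bound for
    \<open>W\<close> at distance \<open>a\<close>. One \<open>g\<close> is spent on
    \<open>W l\<close>, the other is the saving.\<close>
  have Km: "(K * a) powr m * c2 = 2 * g"
    unfolding K_def g_def using c a m by (simp add: powr_mult powr_powr powr_add)
  have g: "0 < g" unfolding g_def using c a by simp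
  have "continuous_on {-1 + a..0} W" by (rule continuous_on_subset[OF W]) (use a in auto)
  then obtain l where l: "l \<in> {-1 + a..0}" "\<forall>y\<in>{-1 + a..0}. W l \<le> W y"
    using continuous_attains_inf[of "{-1 + a..0}" W] a by auto
  \<comment> \<open>For x \<le> 0 the factor 1 - x in 1 - x^2 = (1 + x)(1 - x) is at least
    1.\<close>
  have lower: "c2 * (1 + x) powr m \<le> W x" if "-1 < x" "x \<le> 0" for x
  proof -
    have "1 + x \<le> 1 - x\<^sup>2"
      using that mult_nonneg_nonneg[of "1 + x" "- x"] by (simp add: power2_eq_square algebra_simps)
    then have "c2 * (1 + x) powr m \<le> c2 * (1 - x\<^sup>2) powr m"
      using that c m by (intro mult_left_mono powr_mono2) auto
    also have "\<dots> \<le> W x" using growth[of x] that by auto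
    finally show ?thesis .
  qed
  have "W l \<le> W (-1 + a)" using l a by auto
  also have "\<dots> \<le> c3 * (1 - (-1 + a)\<^sup>2) powr m" using growth[of "-1 + a"] a by auto
  also have "\<dots> \<le> c3 * (2 * a) powr m"
  proof (intro mult_left_mono powr_mono2)
    show "0 \<le> 1 - (-1 + a)\<^sup>2" using a mult_nonneg_nonneg[of a "2 - a"] by (simp add: power2_eq_square algebra_simps)
    show "1 - (-1 + a)\<^sup>2 \<le> 2 * a" by (simp add: power2_eq_square algebra_simps)
  qed (use c m in auto)
  also have "\<dots> = g" unfolding g_def using a by (simp add: powr_mult)
  finally have Wg: "W l \<le> g" .
  have "l \<le> -1 + K * a"
  proof (rule ccontr)
    assume "\<not> ?thesis"
    then have "(K * a) powr m < (1 + l) powr m" using K a m by (intro powr_less_mono2) auto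
    then have "2 * g < c2 * (1 + l) powr m" using Km c by (metis mult.commute mult_less_cancel_left_pos)
    also have "\<dots> \<le> W l" using l a by (intro lower) auto
    finally show False using Wg g by linarith
  qed
  moreover have "W l + g \<le> W x" if "-1 + K * a < x" "x \<le> 0" for x
  proof -
    have "(K * a) powr m \<le> (1 + x) powr m" using K a m that by (intro powr_mono2) auto
    then have "2 * g \<le> c2 * (1 + x) powr m" using Km c by (metis mult.commute mult_le_cancel_left_pos)
    also have "\<dots> \<le> W x" using that K a by (intro lower) (auto intro: less_trans[of _ "-1 + K * a"])
    finally show ?thesis using Wg by linarith
  qed
  ultimately show ?thesis using l Wg a by (intro exI[of _ l]) auto
qed

text \<open>De Giorgi iteration with levels increasing from -1 + a to -1 + 2a and radii decreasing
  from r/2 to r/4, both gaps halving at each step. The level gap contributes 2^p and the radius gap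
  2^\<sigma> per step, hence the ratio \<open>q\<close>. The term \<epsilon>^(-\<sigma>) multiplies
  the constant, so the starting volume must be small relative to \<epsilon>.\<close>

lemma superlevel_vanish:
  fixes u :: "real ^ 'n \<Rightarrow> real"
  assumes p: "1 < p" and s: "0 < s" "s * p < 1" and \<epsilon>: "0 < \<epsilon>" "\<epsilon> < 1"
    and min: "minimizer_bounded s p W \<epsilon> \<Omega> u"
    and \<Omega>: "\<Omega> \<in> sets lebesgue" "bounded \<Omega>" "ball x0 r \<subseteq> \<Omega>"
    and W: "continuous_on {-1..1} W" "\<And>x. x \<in> {-1..1} \<Longrightarrow> 0 \<le> W x"
    and M: "\<And>x. x \<in> {-1<..<1} \<Longrightarrow> W x \<le> M" "0 \<le> M"
    and a: "0 < a" "a \<le> 1/2" and r: "0 < r"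
  defines "D \<equiv> (step_const CARD('n) (s * p) p * (r / 8) powr - (s * p) + M)
      / (gain_const CARD('n) (s * p) * (a / 2) powr p)"
  assumes small: "D * \<epsilon> powr - (s * p) * superlevel_vol u x0 (-1 + a) (r / 2) powr (s * p / CARD('n))
     \<le> (2 powr (s * p + p)) powr (- 1 / (s * p / CARD('n)))"
  shows "superlevel_vol u x0 (-1 + 2 * a) (r / 4) = 0"
proof -
  let ?\<sigma> = "s * p" let ?\<beta> = "s * p / CARD('n)"
  let ?V = "superlevel_vol u x0"
  define q :: real where "q = 2 powr (?\<sigma> + p)"
  define C where "C = step_const CARD('n) ?\<sigma> p"
  define G where "G = gain_const CARD('n) ?\<sigma>"
  define lev where "lev i = -1 + a * (2 - 1 / 2 ^ i)" for i :: nat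
  define rad where "rad i = r / 4 * (1 + 1 / 2 ^ i)" for i :: nat
  define Z where "Z i = ?V (lev i) (rad i)" for i
  have \<sigma>: "0 < ?\<sigma>" using p s by simp
  have \<beta>: "0 < ?\<beta>" using \<sigma> by simp
  have q: "1 < q" unfolding q_def using \<sigma> p by simp
  have C: "0 < C" unfolding C_def by (rule step_const_pos[OF \<sigma> s(2)])
  have G: "0 < G" unfolding G_def by (rule gain_const_pos)
  have D: "0 \<le> D" unfolding D_def C_def[symmetric] G_def[symmetric] using C G M by simp
  have um: "u \<in> borel_measurable lebesgue"
    using min Xsp_D(1) by (auto simp: minimizer_bounded_def)
  have pow1: "(1::real) / 2 ^ i \<le> 1" "0 < (1::real) / 2 ^ i" for i :: nat
    by (auto simp: field_simps)
  have DG: "D * (G * (a / 2) powr p) = C * (r / 8) powr - ?\<sigma> + M"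
    unfolding D_def C_def[symmetric] G_def[symmetric] using G a by simp
  have rec: "Z (Suc i) \<le> (D * \<epsilon> powr - ?\<sigma>) * q ^ i * Z i powr (1 + ?\<beta>)" for i
  proof -
    have dl: "lev (Suc i) - lev i = (a / 2) * (1 / 2) ^ i"
      unfolding lev_def by (simp add: field_simps power_one_over)
    have dr: "rad i - rad (Suc i) = (r / 8) * (1 / 2) ^ i"
      unfolding rad_def by (simp add: field_simps power_one_over)
    have ll: "-1 \<le> lev i" "lev i < lev (Suc i)" "lev i \<le> 1" "lev i \<in> {-1<..<1}"
    proof -
      have "0 < (a / 2) * (1 / 2) ^ i" using a by simp
      then show "lev i < lev (Suc i)" using dl by linarith
      have "0 < a * (2 - 1 / 2 ^ i)" using a pow1[of i] by (intro mult_pos_pos) linarith+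
      moreover have "a * (2 - 1 / 2 ^ i) < 1"
      proof -
        have "a * (2 - 1 / 2 ^ i) < a * 2" using a pow1[of i] by (intro mult_strict_left_mono) linarith+
        then show ?thesis using a by linarith
      qed
      ultimately show "-1 \<le> lev i" "lev i \<le> 1" "lev i \<in> {-1<..<1}" unfolding lev_def using a by auto
    qed
    have rr: "rad (Suc i) < rad i"
    proof -
      have "0 < (r / 8) * (1 / 2) ^ i" using r by simp
      then show ?thesis using dr by linarith
    qed
    have "rad i \<le> r / 4 * (1 + 1)" unfolding rad_def using pow1[of i] r by (intro mult_left_mono) auto
    then have "rad i \<le> r" using r by simp
    then have "ball x0 (rad i) \<subseteq> ball x0 r" by (rule subset_ball)
    then have bO: "ball x0 (rad i) \<subseteq> \<Omega>" using \<Omega>(3) by blast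
    have dec: "G * ((a / 2) * (1 / 2) ^ i) powr p * Z (Suc i)
        \<le> (C * ((r / 8) * (1 / 2) ^ i) powr - ?\<sigma> + \<epsilon> powr - ?\<sigma> * M) * Z i powr (1 + ?\<beta>)"
      using superlevel_decay_nonlinear[OF p s min \<Omega>(1,2) bO W ll(1-3) rr M(1)[OF ll(4)]]
      unfolding dl dr C_def G_def Z_def .
    define P where "P = (1 / 2 :: real) ^ i"
    have P: "0 < P" "P \<le> 1" unfolding P_def by (auto simp: power_le_one)
    have e1: "1 \<le> \<epsilon> powr - ?\<sigma>"
      using powr_mono2'[of "- ?\<sigma>" \<epsilon> 1] \<epsilon> \<sigma> by simp
    have P1: "1 \<le> P powr - ?\<sigma>"
      using powr_mono2'[of "- ?\<sigma>" P 1] P \<sigma> by simp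
    \<comment> \<open>Both factors are at least 1, so the product dominates the radius term and the
      potential term alike and a single constant \<open>D\<close> suffices.\<close>
    define E where "E = \<epsilon> powr - ?\<sigma> * P powr - ?\<sigma>"
    have "C * ((r / 8) * P) powr - ?\<sigma> + \<epsilon> powr - ?\<sigma> * M
        = (C * (r / 8) powr - ?\<sigma>) * P powr - ?\<sigma> + M * \<epsilon> powr - ?\<sigma>"
      using P r by (simp only: powr_mult mult.assoc mult.commute[of M])
    also have "\<dots> \<le> (C * (r / 8) powr - ?\<sigma>) * E + M * E"
      unfolding E_def using C M e1 P1 by (intro add_mono mult_left_mono) (auto simp: mult_le_cancel_left1 mult_le_cancel_right1)
    also have "\<dots> = (D * (G * (a / 2) powr p)) * E"
      unfolding DG by (simp add: distrib_right)
    finally have cf: "C * ((r / 8) * P) powr - ?\<sigma> + \<epsilon> powr - ?\<sigma> * M \<le> (D * (G * (a / 2) powr p)) * E" .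
    have "(G * (a / 2) powr p) * (P powr p * Z (Suc i)) = G * ((a / 2) * P) powr p * Z (Suc i)"
    proof -
      have "((a / 2) * P) powr p = (a / 2) powr p * P powr p" using a P by (subst powr_mult) auto
      then show ?thesis by (simp only: mult_ac)
    qed
    also have "\<dots> \<le> (D * (G * (a / 2) powr p)) * E * Z i powr (1 + ?\<beta>)"
      using order_trans[OF dec[folded P_def] mult_right_mono[OF cf]] by simp
    also have "\<dots> = (G * (a / 2) powr p) * (D * E * Z i powr (1 + ?\<beta>))" by (simp only: mult_ac)
    finally have "P powr p * Z (Suc i) \<le> D * E * Z i powr (1 + ?\<beta>)"
      by (rule mult_left_le_imp_le) (use G a in auto)
    then have "P powr - p * (P powr p * Z (Suc i)) \<le> P powr - p * (D * E * Z i powr (1 + ?\<beta>))"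
      by (rule mult_left_mono) simp
    moreover have "P powr - p * P powr p = 1" using P by (simp add: powr_add[symmetric])
    ultimately have "Z (Suc i) \<le> (D * \<epsilon> powr - ?\<sigma>) * (P powr - ?\<sigma> * P powr - p) * Z i powr (1 + ?\<beta>)"
      unfolding E_def by (simp add: mult.assoc[symmetric]) (simp add: mult_ac)
    moreover have "P powr - ?\<sigma> * P powr - p = q ^ i"
    proof -
      have "P = 2 powr - real i" unfolding P_def by (simp add: powr_minus powr_realpow power_one_over inverse_eq_divide)
      then have "P powr - ?\<sigma> * P powr - p = 2 powr (real i * (?\<sigma> + p))"
        by (simp add: powr_powr powr_add[symmetric] algebra_simps)
      also have "\<dots> = q ^ i" unfolding q_def by (simp add: powr_powr powr_realpow[symmetric] mult.commute)
      finally show ?thesis .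
    qed
    ultimately show ?thesis by simp
  qed
  have Z0: "Z 0 = ?V (-1 + a) (r / 2)" unfolding Z_def lev_def rad_def by simp
  have decay: "Z i \<le> Z 0 * (q powr (- 1 / ?\<beta>)) ^ i" for i
    using \<beta> q D rec small unfolding Z0[symmetric] q_def[symmetric]
    by (intro superlinear_recursion_decay[where D = "D * \<epsilon> powr - ?\<sigma>"]) (auto simp: Z_def)
  \<comment> \<open>All sets of the iteration contain this limiting set, so its volume is below a
    geometric sequence tending to 0.\<close>
  have "?V (-1 + 2 * a) (r / 4) \<le> Z 0 * (q powr (- 1 / ?\<beta>)) ^ i" for i
  proof -
    have "lev i \<le> -1 + 2 * a"
      unfolding lev_def using a pow1[of i] by (simp add: algebra_simps)
    moreover have "r / 4 \<le> rad i" unfolding rad_def using r pow1[of i] by (simp add: algebra_simps)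
    ultimately have "?V (-1 + 2 * a) (r / 4) \<le> Z i"
      unfolding Z_def by (rule superlevel_vol_mono[OF um])
    then show ?thesis using decay[of i] by linarith
  qed
  moreover have "(\<lambda>i. Z 0 * (q powr (- 1 / ?\<beta>)) ^ i) \<longlonglongrightarrow> Z 0 * 0"
  proof (intro tendsto_intros LIMSEQ_power_zero)
    have "- 1 / ?\<beta> < 0" by (rule divide_neg_pos[OF _ \<beta>]) simp
    from powr_less_mono[OF this q] have "q powr (- 1 / ?\<beta>) < 1" using q by simp
    then show "norm (q powr (- 1 / ?\<beta>)) < 1" by simp
  qed
  ultimately have "?V (-1 + 2 * a) (r / 4) \<le> 0"
    by (intro LIMSEQ_le_const) auto
  then show ?thesis using superlevel_vol_nonneg[of u x0 "-1 + 2 * a" "r / 4"] by linarith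
qed

text \<open>Induction on \<open>j\<close> with one linear step from level -1 + b to -1 + K b, where
  b = K^j a; the base case is the volume of the whole ball. The saving \<open>g\<close> grows like
  (K^m)^j and the cost of the shrinking radii grows no faster, so the normalization
  \<open>aN\<close> gives the factor 1/A at every step. Levels stop at -1/2 because the absorption
  of the loss on \<open>u > 0\<close> uses the gain above -1/2.\<close>

lemma superlevel_geometric_decay:
  fixes u :: "real ^ 'n \<Rightarrow> real"
  assumes p: "1 < p" and s: "0 < s" "s * p < 1" and m: "1 \<le> m" and c: "0 < c2" "c2 \<le> c3"
    and \<epsilon>: "0 < \<epsilon>"
    and min: "minimizer_bounded s p W \<epsilon> \<Omega> u"
    and \<Omega>: "\<Omega> \<in> sets lebesgue" "bounded \<Omega>" "ball x0 r \<subseteq> \<Omega>"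
    and W: "continuous_on {-1..1} W" "\<And>x. x \<in> {-1..1} \<Longrightarrow> 0 \<le> W x"
    and growth: "\<And>x. x \<in> {-1<..<1} \<Longrightarrow> c2 * (1 - x\<^sup>2) powr m \<le> W x \<and> W x \<le> c3 * (1 - x\<^sup>2) powr m"
    and r: "0 < r" and a: "0 < a"
  defines "\<beta> \<equiv> s * p / CARD('n)"
    and "K \<equiv> (2 powr (m + 1) * c3 / c2) powr (1 / m)"
  defines "A \<equiv> K powr (2 * m / \<beta>)"
    and "B \<equiv> unit_ball_vol CARD('n) * r ^ CARD('n)"
  defines "N \<equiv> A * step_const CARD('n) (s * p) p * (r / 4) powr - (s * p)"
  assumes aN: "\<epsilon> powr - (s * p) * (2 powr m * c3 * a powr m) = N"
    and \<mu>: "superlevel_vol u x0 (-1/2) r \<le> (gain_const CARD('n) (s * p) * (1/2) powr p / (2 * N)) powr (2 / \<beta>) / B"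
    and j: "K ^ j * a \<le> 1 / 2"
  shows "superlevel_vol u x0 (-1 + K ^ j * a) (r / 2 * (1 + 1 / 2 ^ j)) \<le> B * inverse (A ^ j)"
  using j
proof (induction j)
  case 0
  then show ?case using superlevel_vol_le_ball[of r u x0 "-1 + a"] r by (simp add: B_def)
next
  case (Suc j)
  let ?\<sigma> = "s * p"
  let ?V = "superlevel_vol u x0"
  define C where "C = step_const CARD('n) ?\<sigma> p"
  define G where "G = gain_const CARD('n) ?\<sigma> * (1/2) powr p"
  define rad where "rad i = r / 2 * (1 + 1 / 2 ^ i)" for i :: nat
  define b where "b = K ^ j * a"
  \<comment> \<open>the geometric mean of the bounds \<open>\<mu>\<close> and \<open>B A\<^bsup>-j\<^esup>\<close>: by the choice of \<open>A\<close>, the powers of \<open>K\<close> in \<open>Q2\<close> cancel\<close>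
  define Q where "Q = ((G / (2 * N)) powr (2 / \<beta>) * inverse (A ^ j)) powr (1 / 2)"
  define g where "g = 2 powr m * c3 * b powr m"
  have \<sigma>: "0 < ?\<sigma>" using p s by simp
  have \<beta>: "0 < \<beta>" unfolding \<beta>_def using \<sigma> by simp
  have C: "0 < C" unfolding C_def by (rule step_const_pos[OF \<sigma> s(2)])
  have G: "0 < G" unfolding G_def using gain_const_pos by simp
  have Km: "K powr m = 2 powr (m + 1) * c3 / c2"
    unfolding K_def using c m by (simp add: powr_powr)
  \<comment> \<open>Besides giving \<open>K \<ge> 1\<close>, this yields 2^\<sigma> \<le> 2 \<le>
    K^m, so halving the radius gap costs no more than the growth of \<open>g\<close>
    provides.\<close>
  have Km2: "2 \<le> K powr m"
  proof -
    have "2 powr 1 \<le> (2::real) powr (m + 1)" using m by (intro powr_mono) auto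
    then have "2 * 1 \<le> 2 powr (m + 1) * (c3 / c2)" using c by (intro mult_mono) auto
    then show ?thesis unfolding Km by simp
  qed
  have K1: "1 \<le> K"
  proof (rule ccontr)
    assume "\<not> 1 \<le> K"
    then have "K powr m \<le> 1 powr m" using m c unfolding K_def by (intro powr_mono2) auto
    then show False using Km2 by simp
  qed
  have K: "0 < K" using K1 by linarith
  have A: "0 < A" unfolding A_def using K by simp
  have B: "0 < B" unfolding B_def using r by simp
  have N: "0 < N" unfolding N_def C_def[symmetric] using A C r by simp
  have b: "0 < b" "b \<le> 1 / 2" "K * b \<le> 1 / 2"
  proof -
    show "0 < b" unfolding b_def using K a by simp
    show kb: "K * b \<le> 1 / 2" using Suc.prems unfolding b_def by (simp add: mult_ac)
    have "1 * b \<le> K * b" using K1 \<open>0 < b\<close> by (intro mult_right_mono) auto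
    then show "b \<le> 1 / 2" using kb by linarith
  qed
  have IH: "?V (-1 + b) (rad j) \<le> B * inverse (A ^ j)"
    using Suc.IH b(2) unfolding b_def rad_def by simp
  have um: "u \<in> borel_measurable lebesgue"
    using min Xsp_D(1) by (auto simp: minimizer_bounded_def)
  have pow1: "(1::real) / 2 ^ i \<le> 1" "0 < (1::real) / 2 ^ i" for i :: nat
    by (auto simp: field_simps)
  have c3: "0 < c3" using c by linarith
  obtain l where l: "-1 + b \<le> l" "l \<le> 0" "l \<le> -1 + K * b" "W l \<le> g"
    "\<And>x. l < x \<Longrightarrow> x \<le> 0 \<Longrightarrow> W l \<le> W x" "\<And>x. -1 + K * b < x \<Longrightarrow> x \<le> 0 \<Longrightarrow> W l + g \<le> W x"
    using ex_truncation_level[OF m c(1) c3 W(1) growth b(1)] b(2)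
    unfolding K_def[symmetric] g_def[symmetric] by auto
  have rr: "rad j - rad (Suc j) = r / 4 * (1 / 2) ^ j"
    unfolding rad_def by (simp add: field_simps power_one_over)
  have "0 < r / 4 * (1 / 2) ^ j" using r by simp
  then have rr': "rad (Suc j) < rad j" using rr by linarith
  have radr: "rad j \<le> r"
  proof -
    have "rad j \<le> r / 2 * (1 + 1)" unfolding rad_def using pow1[of j] r by (intro mult_left_mono) auto
    then show ?thesis by simp
  qed
  then have bO: "ball x0 (rad j) \<subseteq> \<Omega>" using \<Omega>(3) by (meson order_trans subset_ball)
  have g0: "0 < g" unfolding g_def using c b by simp
  have eg: "\<epsilon> powr - ?\<sigma> * g = N * (K powr m) ^ j"
  proof -
    have "b powr m = (K powr m) ^ j * a powr m"
      unfolding b_def using K a by (simp add: powr_mult powr_realpow[symmetric] powr_powr mult.commute del: powr_realpow)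
    then have "\<epsilon> powr - ?\<sigma> * g = (\<epsilon> powr - ?\<sigma> * (2 powr m * c3 * a powr m)) * (K powr m) ^ j"
      unfolding g_def by (simp only: mult_ac)
    then show ?thesis unfolding aN .
  qed
  \<comment> \<open>A quantity below two bounds is below their geometric mean; the factors
    \<open>B\<close> cancel in the product.\<close>
  have Q1: "?V (-1/2) (rad j) \<le> Q"
  proof -
    have v1: "?V (-1/2) (rad j) \<le> (G / (2 * N)) powr (2 / \<beta>) / B"
      using superlevel_vol_mono[OF um order_refl radr, of x0 "-1/2"] \<mu> unfolding G_def by linarith
    have v2: "?V (-1/2) (rad j) \<le> B * inverse (A ^ j)"
      using superlevel_vol_mono[OF um _ order_refl, of "-1 + b" "-1/2" x0 "rad j"] b(2) IH by linarith
    have "?V (-1/2) (rad j) * ?V (-1/2) (rad j) \<le> ((G / (2 * N)) powr (2 / \<beta>) / B) * (B * inverse (A ^ j))"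
      using v1 v2 B by (intro mult_mono) auto
    also have "\<dots> = (G / (2 * N)) powr (2 / \<beta>) * inverse (A ^ j)" using B by simp
    finally have "sqrt (?V (-1/2) (rad j) * ?V (-1/2) (rad j)) \<le> sqrt ((G / (2 * N)) powr (2 / \<beta>) * inverse (A ^ j))"
      by (rule real_sqrt_le_mono)
    then show ?thesis unfolding Q_def using A by (simp add: powr_half_sqrt)
  qed
  have Q2: "2 * (\<epsilon> powr - ?\<sigma> * g) \<le> gain_const CARD('n) ?\<sigma> * (1/2) powr p * Q powr - (?\<sigma> / CARD('n))"
  proof -
    have "A ^ j = (K powr m) powr (2 / \<beta> * real j)"
      unfolding A_def using K by (simp add: powr_powr powr_realpow[symmetric] mult_ac del: powr_realpow)
    then have "inverse (A ^ j) = ((K powr m) ^ j) powr - (2 / \<beta>)"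
      using K by (simp add: powr_minus powr_powr powr_realpow[symmetric] mult_ac del: powr_realpow)
    moreover have "(G / (2 * N)) powr (2 / \<beta>) = (2 * N / G) powr - (2 / \<beta>)"
      using G N by (simp add: powr_minus powr_divide)
    ultimately have "Q = ((2 * N / G) powr - (2 / \<beta>) * ((K powr m) ^ j) powr - (2 / \<beta>)) powr (1 / 2)"
      unfolding Q_def by simp
    then have "Q = ((2 * N / G * (K powr m) ^ j) powr - (2 / \<beta>)) powr (1 / 2)"
      using G N K by (subst powr_mult) auto
    then have "Q powr - \<beta> = 2 * N / G * (K powr m) ^ j"
      using \<beta> G N K by (simp add: powr_powr)
    then show ?thesis
      unfolding eg G_def[symmetric] \<beta>_def[symmetric] using G by simp
  qed
  have l1: "-1 \<le> l" "-1 + K * b \<le> - 1/2" using l b by auto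
  have step: "\<epsilon> powr - ?\<sigma> * g * ?V (-1 + K * b) (rad (Suc j)) \<le> C * (r / 4 * (1 / 2) ^ j) powr - ?\<sigma> * ?V l (rad j)"
    unfolding C_def rr[symmetric]
    by (rule superlevel_decay_linear[OF p s \<epsilon> min \<Omega>(1,2) bO W l1(1) l(3) l1(2) rr' g0 l(4,5,6) Q1 Q2])
  have h: "(r / 4 * (1 / 2) ^ j) powr - ?\<sigma> \<le> (r / 4) powr - ?\<sigma> * (K powr m) ^ j"
  proof -
    have "((1 / 2 :: real) ^ j) powr - ?\<sigma> = (2 powr ?\<sigma>) ^ j"
      by (simp add: powr_minus powr_power power_one_over powr_divide)
        (simp add: powr_realpow[symmetric] powr_powr mult.commute del: powr_realpow)
    also have "\<dots> \<le> (K powr m) ^ j"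
    proof (rule power_mono)
      have "2 powr ?\<sigma> \<le> (2::real) powr 1" using s by (intro powr_mono) auto
      then show "2 powr ?\<sigma> \<le> K powr m" using Km2 by simp
    qed simp
    finally show ?thesis using r by (subst powr_mult) (auto intro: mult_left_mono)
  qed
  have Vl: "?V l (rad j) \<le> B * inverse (A ^ j)"
    using superlevel_vol_mono[OF um l(1) order_refl, of x0 "rad j"] IH by linarith
  have "C * (r / 4 * (1 / 2) ^ j) powr - ?\<sigma> * ?V l (rad j)
      \<le> C * ((r / 4) powr - ?\<sigma> * (K powr m) ^ j) * (B * inverse (A ^ j))"
    using C h Vl by (intro mult_mono mult_left_mono) auto
  \<comment> \<open>\<open>N\<close> contains a factor \<open>A\<close>, which provides the
    additional inverse power.\<close>
  also have "\<dots> = N * (K powr m) ^ j * (B * inverse (A ^ Suc j))"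
    unfolding N_def C_def[symmetric] using A by simp
  finally have "N * (K powr m) ^ j * ?V (-1 + K * b) (rad (Suc j)) \<le> N * (K powr m) ^ j * (B * inverse (A ^ Suc j))"
    using step unfolding eg by linarith
  then have "?V (-1 + K * b) (rad (Suc j)) \<le> B * inverse (A ^ Suc j)"
    by (rule mult_left_le_imp_le) (use N K in auto)
  then show ?case unfolding b_def rad_def by (simp add: mult.assoc)
qed

section \<open>Convergence of the level sets\<close>

lemma ex_power_level:
  fixes K a b :: real
  assumes "1 < K" "0 < b" "b \<le> a"
  shows "\<exists>J. K ^ J * b \<le> a \<and> a < K * (K ^ J * b)"
proof -
  obtain n where "a / b < K ^ n" using real_arch_pow[OF assms(1)] by blast
  then have ex: "\<exists>n. a < K ^ n * b" using assms by (auto simp: field_simps)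
  define n where "n = (LEAST n. a < K ^ n * b)"
  have n: "a < K ^ n * b" unfolding n_def by (rule LeastI_ex[OF ex])
  then have "n \<noteq> 0" using assms by (intro notI) auto
  then obtain J where J: "n = Suc J" by (meson not0_implies_Suc)
  have "\<not> a < K ^ J * b"
    using not_less_Least[of J "\<lambda>n. a < K ^ n * b"] J unfolding n_def by simp
  then show ?thesis using n J by (intro exI[of _ J]) (auto simp: mult.assoc)
qed

text \<open>With t = \<epsilon>^\<sigma>, the linear iteration starts at a level \<open>b\<close>
  with b^m of order t and runs up to \<open>a\<close>. It leaves a volume whose \<beta>-th power is
  of order t^2, and this beats the factor 1/t in the hypothesis of \<open>superlevel_vanish\<close>.
  The thresholds depend on neither the domain, the minimizer nor the centre, so one choice serves
  all points at once.\<close>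

lemma superlevel_vol_eq_0_of_small:
  fixes W :: "real \<Rightarrow> real"
  assumes p: "1 < p" and s: "0 < s" "s * p < 1" and m: "1 \<le> m" and c2: "0 < c2"
    and W: "continuous_on {-1..1} W" "\<And>x. x \<in> {-1..1} \<Longrightarrow> 0 \<le> W x"
    and growth: "\<And>x. x \<in> {-1<..<1} \<Longrightarrow> c2 * (1 - x\<^sup>2) powr m \<le> W x \<and> W x \<le> c3 * (1 - x\<^sup>2) powr m"
    and r: "0 < r" and a: "0 < a" "a \<le> 1/2"
  shows "\<exists>\<mu>>0. \<exists>\<epsilon>1>0. \<forall>\<epsilon> \<Omega> (u :: real ^ 'n \<Rightarrow> real) x0. 0 < \<epsilon> \<and> \<epsilon> < \<epsilon>1 \<and> \<epsilon> < 1 \<and>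
      minimizer_bounded s p W \<epsilon> \<Omega> u \<and> \<Omega> \<in> sets lebesgue \<and> bounded \<Omega> \<and> ball x0 r \<subseteq> \<Omega> \<and>
      superlevel_vol u x0 (-1/2) r \<le> \<mu> \<longrightarrow> superlevel_vol u x0 (-1 + 2 * a) (r / 4) = 0"
proof -
  define \<sigma> where "\<sigma> = s * p"
  define \<beta> where "\<beta> = s * p / CARD('n)"
  define K where "K = (2 powr (m + 1) * c3 / c2) powr (1 / m)"
  define A where "A = K powr (2 * m / \<beta>)"
  define B where "B = unit_ball_vol CARD('n) * r ^ CARD('n)"
  define N where "N = A * step_const CARD('n) (s * p) p * (r / 4) powr - (s * p)"
  define \<mu> where "\<mu> = (gain_const CARD('n) (s * p) * (1/2) powr p / (2 * N)) powr (2 / \<beta>) / B"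
  define D where "D = (step_const CARD('n) (s * p) p * (r / 8) powr - (s * p) + c3)
      / (gain_const CARD('n) (s * p) * (a / 2) powr p)"
  define T where "T = (2 powr (s * p + p)) powr (- 1 / (s * p / CARD('n)))"
  have \<sigma>: "0 < \<sigma>" unfolding \<sigma>_def using p s by simp
  have \<beta>: "0 < \<beta>" unfolding \<beta>_def using p s by simp
  have c23: "c2 \<le> c3" using growth[of 0] by simp
  have c3: "0 < c3" using c2 c23 by linarith
  have stp: "0 < step_const CARD('n) (s * p) p"
    using step_const_pos[OF _ s(2)] \<sigma> unfolding \<sigma>_def by simp
  have gp: "0 < gain_const CARD('n) (s * p)" by (rule gain_const_pos)
  have K0: "0 < K" unfolding K_def using c2 c3 by simp
  have K1: "1 < K"
  proof (rule ccontr)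
    assume "\<not> 1 < K"
    then have "K powr m \<le> 1 powr m" using K0 m by (intro powr_mono2) auto
    moreover have "K powr m = 2 powr (m + 1) * (c3 / c2)"
      unfolding K_def using c2 c3 m by (simp add: powr_powr)
    moreover have "2 powr 1 * 1 \<le> 2 powr (m + 1) * (c3 / c2)"
      using m c2 c23 by (intro mult_mono powr_mono) auto
    ultimately show False by simp
  qed
  have A0: "0 < A" unfolding A_def using K0 by simp
  have B0: "0 < B" unfolding B_def using r by simp
  have N0: "0 < N" unfolding N_def using A0 stp r by simp
  have \<mu>0: "0 < \<mu>" unfolding \<mu>_def using gp N0 B0 by simp
  have D0: "0 < D" unfolding D_def using stp r c3 gp a by (intro divide_pos_pos add_nonneg_pos) auto
  have T0: "0 < T" unfolding T_def by simp
  define H where "H = 2 powr m * c3"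
  have H0: "0 < H" unfolding H_def using c3 by simp
  \<comment> \<open>From K^(-J) < K b / a and b^m = N t / H one gets A^(-J) \<le> (E
    t)^(2/\<beta>).\<close>
  define E where "E = (K / a) powr m * (N / H)"
  have E0: "0 < E" unfolding E_def using K0 a N0 H0 by simp
  \<comment> \<open>The first entry ensures that the starting level \<open>b\<close> does not exceed
    \<open>a\<close>, the second is the smallness required by
    \<open>superlevel_vanish\<close>.\<close>
  define \<delta> where "\<delta> = min (a powr m * H / N) (T / (D * (B powr \<beta> * E\<^sup>2)))"
  have \<delta>0: "0 < \<delta>" unfolding \<delta>_def using a H0 N0 T0 D0 B0 E0 by simp
  define \<epsilon>1 where "\<epsilon>1 = \<delta> powr (1 / \<sigma>)"
  have \<epsilon>10: "0 < \<epsilon>1" unfolding \<epsilon>1_def using \<delta>0 by simp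
  have "superlevel_vol u x0 (-1 + 2 * a) (r / 4) = 0"
    if \<epsilon>: "0 < \<epsilon>" "\<epsilon> < \<epsilon>1" "\<epsilon> < 1" and min: "minimizer_bounded s p W \<epsilon> \<Omega> u"
      and \<Omega>: "\<Omega> \<in> sets lebesgue" "bounded \<Omega>" "ball x0 r \<subseteq> \<Omega>"
      and small: "superlevel_vol u x0 (-1/2) r \<le> \<mu>"
    for \<epsilon> \<Omega> and u :: "real ^ 'n \<Rightarrow> real" and x0
  proof -
    let ?V = "superlevel_vol u x0"
    have um: "u \<in> borel_measurable lebesgue"
      using min Xsp_D(1) by (auto simp: minimizer_bounded_def)
    define t where "t = \<epsilon> powr \<sigma>"
    have t0: "0 < t" unfolding t_def using \<epsilon> by simp
    have "t \<le> \<epsilon>1 powr \<sigma>" unfolding t_def using \<epsilon> \<sigma> by (intro powr_mono2) auto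
    also have "\<dots> = \<delta>" unfolding \<epsilon>1_def using \<delta>0 \<sigma> by (simp add: powr_powr)
    finally have t1: "t \<le> a powr m * H / N" and t2: "t \<le> T / (D * (B powr \<beta> * E\<^sup>2))"
      unfolding \<delta>_def by auto
    have tneg: "\<epsilon> powr - \<sigma> = inverse t" unfolding t_def by (simp add: powr_minus)
    \<comment> \<open>The solution of the normalization required by
      \<open>superlevel_geometric_decay\<close>: the saving at the first level, divided by t, equals
      \<open>N\<close>.\<close>
    define b where "b = (N * t / H) powr (1 / m)"
    have b0: "0 < b" unfolding b_def using N0 t0 H0 by simp
    have bm: "b powr m = N * t / H" unfolding b_def using m N0 t0 H0 by (simp add: powr_powr)
    have ba: "b \<le> a"
    proof (rule ccontr)
      assume "\<not> b \<le> a"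
      then have "a powr m < b powr m" using a m by (intro powr_less_mono2) auto
      moreover have "b powr m \<le> a powr m" unfolding bm using t1 N0 H0 by (simp add: field_simps)
      ultimately show False by linarith
    qed
    obtain J where J: "K ^ J * b \<le> a" "a < K * (K ^ J * b)" using ex_power_level[OF K1 b0 ba] by blast
    have "\<epsilon> powr - \<sigma> * (2 powr m * c3 * b powr m) = N"
      unfolding bm tneg H_def[symmetric] using t0 H0 by simp
    note geom = superlevel_geometric_decay[OF p s m c2 c23 \<epsilon>(1) min \<Omega> W growth r b0, of J]
    have "?V (-1 + K ^ J * b) (r / 2 * (1 + 1 / 2 ^ J)) \<le> B * inverse (A ^ J)"
      unfolding B_def A_def \<beta>_def K_def
    proof (rule geom)
      show "\<epsilon> powr - (s * p) * (2 powr m * c3 * b powr m) =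
        ((2 powr (m + 1) * c3 / c2) powr (1 / m)) powr (2 * m / (s * p / real CARD('n))) *
        step_const CARD('n) (s * p) p * (r / 4) powr - (s * p)"
        using \<open>\<epsilon> powr - \<sigma> * (2 powr m * c3 * b powr m) = N\<close>
        unfolding \<sigma>_def N_def A_def K_def \<beta>_def .
      show "?V (- 1 / 2) r
        \<le> (gain_const CARD('n) (s * p) * (1 / 2) powr p /
           (2 * (((2 powr (m + 1) * c3 / c2) powr (1 / m)) powr (2 * m / (s * p / real CARD('n))) *
        step_const CARD('n) (s * p) p * (r / 4) powr - (s * p)))) powr (2 / (s * p / real CARD('n))) /
          (unit_ball_vol (real CARD('n)) * r ^ CARD('n))"
        using small unfolding \<mu>_def N_def A_def K_def \<beta>_def B_def .
      show "((2 powr (m + 1) * c3 / c2) powr (1 / m)) ^ J * b \<le> 1 / 2"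
        using J(1) a(2) unfolding K_def by linarith
    qed
    moreover have "?V (-1 + a) (r / 2) \<le> ?V (-1 + K ^ J * b) (r / 2 * (1 + 1 / 2 ^ J))"
      using J(1) r by (intro superlevel_vol_mono[OF um]) auto
    moreover have "inverse (A ^ J) \<le> (E * t) powr (2 / \<beta>)"
    proof -
      have "inverse (A ^ J) = inverse (K ^ J) powr (2 * m / \<beta>)"
        unfolding A_def using K0 by (simp add: powr_powr powr_realpow[symmetric] powr_minus[symmetric] mult_ac del: powr_realpow)
      also have "\<dots> \<le> (K * b / a) powr (2 * m / \<beta>)"
      proof (rule powr_mono2)
        show "inverse (K ^ J) \<le> K * b / a" using J(2) K0 a b0 by (simp add: field_simps)
      qed (use K0 m \<beta> in auto)
      also have "\<dots> = ((K / a * b) powr m) powr (2 / \<beta>)"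
        by (simp add: powr_powr mult_ac)
      also have "(K / a * b) powr m = E * t"
      proof -
        have "(K / a * b) powr m = (K / a) powr m * b powr m" using K0 a b0 by (subst powr_mult) auto
        then show ?thesis unfolding bm E_def by simp
      qed
      finally show ?thesis .
    qed
    ultimately have Z: "?V (-1 + a) (r / 2) \<le> B * (E * t) powr (2 / \<beta>)"
      using B0 by (meson less_imp_le mult_left_mono order_trans)
    have "?V (-1 + a) (r / 2) powr \<beta> \<le> (B * (E * t) powr (2 / \<beta>)) powr \<beta>"
      using Z \<beta> by (intro powr_mono2) auto
    also have "\<dots> = B powr \<beta> * (E * t)\<^sup>2"
      using B0 E0 t0 \<beta> by (simp add: powr_mult powr_powr power_mult_distrib)
    finally have "D * \<epsilon> powr - \<sigma> * ?V (-1 + a) (r / 2) powr \<beta> \<le> D * inverse t * (B powr \<beta> * (E * t)\<^sup>2)"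
      unfolding tneg using D0 t0 by (intro mult_left_mono) auto
    also have "\<dots> = t * (D * (B powr \<beta> * E\<^sup>2))"
      using t0 by (simp add: power2_eq_square field_simps)
    also have "\<dots> \<le> T"
      using t2 D0 B0 E0 by (subst (asm) pos_le_divide_eq) auto
    finally have fin: "D * \<epsilon> powr - \<sigma> * ?V (-1 + a) (r / 2) powr \<beta> \<le> T" .
    have Wc3: "W x \<le> c3" if "x \<in> {-1<..<1}" for x
    proof -
      have "x\<^sup>2 < 1" using that by (simp add: abs_square_less_1 abs_less_iff)
      then have "(1 - x\<^sup>2) powr m \<le> 1 powr m" using m by (intro powr_mono2) auto
      then have "c3 * (1 - x\<^sup>2) powr m \<le> c3 * 1" using c3 by (intro mult_left_mono) auto
      then show ?thesis using growth[OF that] by linarith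
    qed
    show ?thesis
      by (rule superlevel_vanish[OF p s \<epsilon>(1,3) min \<Omega> W Wc3 less_imp_le[OF c3] a r])
         (use fin in \<open>auto simp: D_def T_def \<sigma>_def \<beta>_def\<close>)
  qed
  then show ?thesis using \<mu>0 \<epsilon>10 by blast
qed

section \<open>Reflection, passage to points, and conclusion\<close>

lemma minimizer_bounded_uminus:
  assumes "minimizer_bounded s p W \<epsilon> \<Omega> u"
  shows "minimizer_bounded s p (\<lambda>x. W (- x)) \<epsilon> \<Omega> (\<lambda>x. - u x)"
proof -
  have g: "gagliardo_kernel s p (\<lambda>x. - v x) = gagliardo_kernel s p v" for v :: "real ^ 'a \<Rightarrow> real"
    by (intro ext) (simp add: gagliardo_kernel_def abs_minus_commute)
  have k: "kinetic_energy s p (\<lambda>x. - v x) \<Omega> = kinetic_energy s p v \<Omega>" for v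
    by (simp add: kinetic_energy_def g)
  have X: "(\<lambda>x. - v x) \<in> Xsp s p \<Omega>" if "v \<in> Xsp s p \<Omega>" for v
    using that by (auto simp: Xsp_def k)
  have t: "total_energy s p (\<lambda>x. W (- x)) \<epsilon> (\<lambda>x. - v x) \<Omega> = total_energy s p W \<epsilon> v \<Omega>" for v
    by (simp add: total_energy_def k)
  show ?thesis
    unfolding minimizer_bounded_def t
  proof (intro conjI ballI impI)
    show "(\<lambda>x. - u x) \<in> Xsp s p \<Omega>" using assms X by (simp add: minimizer_bounded_def)
    fix v assume v: "v \<in> Xsp s p \<Omega>" "\<forall>x. x \<notin> \<Omega> \<longrightarrow> v x = - u x"
    then have "total_energy s p W \<epsilon> u \<Omega> \<le> total_energy s p W \<epsilon> (\<lambda>x. - v x) \<Omega>"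
      using assms X[OF v(1)] by (simp add: minimizer_bounded_def)
    then show "total_energy s p W \<epsilon> u \<Omega> \<le> total_energy s p (\<lambda>x. W (- x)) \<epsilon> v \<Omega>"
      using t[of "\<lambda>x. - v x"] by simp
  qed
qed

text \<open>By continuity the superlevel set in the ball is open, and a nonempty open set is not
  negligible. This turns the measure estimate into a bound at the centre itself.\<close>

lemma le_of_superlevel_vol_eq_0:
  fixes u :: "real ^ 'n \<Rightarrow> real"
  assumes "continuous_on (ball x0 \<rho>) u" "0 < \<rho>" "superlevel_vol u x0 c \<rho> = 0"
  shows "u x0 \<le> c"
proof (rule ccontr)
  assume "\<not> u x0 \<le> c"
  let ?S = "{x \<in> ball x0 \<rho>. c < u x}"
  have S: "?S = ball x0 \<rho> \<inter> u -` {c<..}" by auto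
  have "open ?S" unfolding S by (intro continuous_open_preimage assms) auto
  moreover have "?S \<noteq> {}" using assms(2) \<open>\<not> u x0 \<le> c\<close> by (auto intro!: exI[of _ x0])
  ultimately have "\<not> negligible ?S" by (rule open_not_negligible)
  moreover have "?S \<in> null_sets lebesgue"
    using \<open>open ?S\<close> emeasure_superlevel[of x0 \<rho> c u] assms(3)
    by (intro null_setsI) auto
  ultimately show False by (simp add: negligible_iff_null_sets)
qed

text \<open>Chebyshev's inequality with threshold 1/2. It is used with \<open>f\<close> the distance
  to the limit function, which is -1 on the ball after a possible change of sign.\<close>

lemma superlevel_vol_le_L1:
  fixes u f :: "real ^ 'n \<Rightarrow> real"
  assumes u: "u \<in> borel_measurable lebesgue" and C: "ball x0 r \<subseteq> C"
    and f: "\<And>x. x \<in> ball x0 r \<Longrightarrow> -1/2 < u x \<Longrightarrow> 1/2 \<le> f x"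
    and le: "(\<integral>\<^sup>+x\<in>C. ennreal (f x) \<partial>lebesgue) \<le> ennreal (\<mu> / 2)" and \<mu>: "0 \<le> \<mu>"
  shows "superlevel_vol u x0 (-1/2) r \<le> \<mu>"
proof -
  let ?S = "{x \<in> ball x0 r. -1/2 < u x}"
  have "ennreal (1 / 2 * superlevel_vol u x0 (-1/2) r) = (\<integral>\<^sup>+x. ennreal (1 / 2) * indicator ?S x \<partial>lebesgue)"
    by (subst nn_integral_cmult_indicator[OF superlevel_lebesgue[OF u]], subst emeasure_superlevel)
       (subst ennreal_mult, auto)
  also have "\<dots> \<le> (\<integral>\<^sup>+x\<in>C. ennreal (f x) \<partial>lebesgue)"
    proof (rule nn_integral_mono)
    fix x
    show "ennreal (1 / 2) * indicator ?S x \<le> ennreal (f x) * indicator C x"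
    proof (cases "x \<in> ?S")
      case True
      then have "ennreal (1 / 2) \<le> ennreal (f x)" using f by (intro ennreal_leI) auto
      then show ?thesis using True C by (auto simp: subset_iff)
    qed simp
  qed
  also note le
  finally have "1 / 2 * superlevel_vol u x0 (-1/2) r \<le> \<mu> / 2"
    using \<mu> by (subst (asm) ennreal_le_iff) auto
  then show ?thesis by simp
qed

theorem corollary1p7:
  fixes \<Omega> E :: "(real ^ 'n) set"
    and p s m c2 c3 :: real
    and W :: "real \<Rightarrow> real"
    and \<epsilon> :: "nat \<Rightarrow> real"
    and u :: "nat \<Rightarrow> real ^ 'n \<Rightarrow> real"
  assumes "open \<Omega>"
    and "p > 1" and "0 < s" and "s < 1 / p" and "m \<ge> p"
    and "standing_potential m W"
    and "c2 > 0" and "c3 > 0"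
    and "\<And>x. x \<in> {-1<..<1} \<Longrightarrow>
           c2 * (1 - x\<^sup>2) powr m \<le> W x \<and> W x \<le> c3 * (1 - x\<^sup>2) powr m"
    and "\<And>k. \<epsilon> k \<in> {0<..<1}" and "\<epsilon> \<longlonglongrightarrow> 0"
    and "\<And>k. u k \<in> Xsp s p \<Omega>"
    and "\<And>k. minimizer s p W (\<epsilon> k) \<Omega> (u k)"
    and "\<And>k. continuous_on \<Omega> (u k)"
    and "(SUP k. total_energy s p W (\<epsilon> k) (u k) \<Omega>) < \<infinity>"
    and "E \<in> sets lebesgue"
    and "L1_loc_tendsto \<Omega> u (\<lambda>x. indicator E x - indicator (- E) x)"
  shows "\<forall>\<Theta> \<delta> R. \<Theta> \<in> {0<..<1} \<and> \<delta> > 0 \<and> R > 0 \<and> compactly_contained (ball 0 R) \<Omega> \<longrightarrow>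
           (\<exists>\<epsilon>\<^sub>0>0. \<forall>k. \<epsilon> k < \<epsilon>\<^sub>0 \<longrightarrow>
              {x. \<bar>u k x\<bar> < \<Theta>} \<inter> ball 0 R \<subseteq> (\<Union>x\<in>frontier E. ball x \<delta>))"
proof (intro allI impI, elim conjE)
  fix \<Theta> \<delta> R :: real
  assume \<Theta>: "\<Theta> \<in> {0<..<1}" and \<delta>: "0 < \<delta>" and R: "0 < R" and cc: "compactly_contained (ball (0 :: real ^ 'n) R) \<Omega>"
  note growth = assms(9)
  have sp: "s * p < 1" using assms(2,4) by (simp add: field_simps)
  have m: "1 \<le> m" using assms(2,5) by linarith
  obtain W' where "\<forall>x\<in>{-1..1}. (W has_real_derivative W' x) (at x within {-1..1})"
    using assms(6) unfolding standing_potential_def by blast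
  then have Wc: "continuous_on {-1..1} W"
    by (auto simp: continuous_on_eq_continuous_within intro!: DERIV_continuous)
  have W0: "0 \<le> W x" if "x \<in> {-1..1}" for x
    using assms(6) that unfolding standing_potential_def by blast
  \<comment> \<open>The growth bound is even in x, so the reflected potential satisfies the same
    hypotheses; applied to -u it handles balls contained in \<open>E\<close>.\<close>
  have Wc': "continuous_on {-1..1} (\<lambda>x. W (- x))"
    by (intro continuous_on_compose2[OF Wc] continuous_intros) auto
  have W0': "0 \<le> W (- x)" if "x \<in> {-1..1}" for x using that by (intro W0) auto
  have growth': "c2 * (1 - x\<^sup>2) powr m \<le> W (- x) \<and> W (- x) \<le> c3 * (1 - x\<^sup>2) powr m" if "x \<in> {-1<..<1}" for x
    using growth[of "- x"] that by auto
  \<comment> \<open>Chosen so that the final level -1 + 2a equals -\<Theta>.\<close>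
  define a where "a = (1 - \<Theta>) / 2"
  have a: "0 < a" "a \<le> 1/2" "-1 + 2 * a = - \<Theta>" unfolding a_def using \<Theta> by (auto simp: field_simps)
  have cb: "cball 0 R \<subseteq> \<Omega>" using cc R by (simp add: compactly_contained_def)
  obtain r0 where r0: "0 < r0" "(\<Union>x\<in>cball 0 R. ball x r0) \<subseteq> \<Omega>"
    using compact_subset_open_imp_ball_epsilon_subset[OF compact_cball assms(1) cb] by blast
  \<comment> \<open>The bound by \<delta> keeps the ball of radius \<open>r\<close> around the point
    under study away from the frontier of \<open>E\<close>; strictness below \<open>r0\<close> keeps
    its closure inside \<Omega>.\<close>
  define r where "r = min (r0 / 2) \<delta>"
  have r: "0 < r" "r < r0" "r \<le> \<delta>" unfolding r_def using r0 \<delta> by auto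
  \<comment> \<open>A single compact set containing all balls of radius \<open>r\<close> centred in
    \<open>ball 0 R\<close>, so that one convergence statement controls all centres
    uniformly.\<close>
  define C where "C = {x + y |x y. x \<in> cball (0 :: real ^ 'n) R \<and> y \<in> cball 0 r}"
  have C: "compact C" unfolding C_def by (intro compact_sums) auto
  have CO: "C \<subseteq> \<Omega>"
  proof
    fix z assume "z \<in> C"
    then obtain x y where xy: "z = x + y" "x \<in> cball 0 R" "norm y \<le> r" unfolding C_def by auto
    then have "z \<in> ball x r0" using r by (simp add: dist_norm)
    then show "z \<in> \<Omega>" using xy r0 by blast
  qed
  have cbC: "cball x r \<subseteq> C" if "x \<in> ball 0 R" for x
  proof
    fix z assume "z \<in> cball x r"
    then have "z = x + (z - x)" "x \<in> cball 0 R" "z - x \<in> cball 0 r"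
      using that by (auto simp: dist_norm norm_minus_commute)
    then show "z \<in> C" unfolding C_def by blast
  qed
  obtain \<mu>1 \<epsilon>1 where 1: "0 < \<mu>1" "0 < \<epsilon>1"
    "\<And>\<epsilon> \<Omega> (u :: real ^ 'n \<Rightarrow> real) x0. 0 < \<epsilon> \<and> \<epsilon> < \<epsilon>1 \<and> \<epsilon> < 1 \<and>
      minimizer_bounded s p W \<epsilon> \<Omega> u \<and> \<Omega> \<in> sets lebesgue \<and> bounded \<Omega> \<and> ball x0 r \<subseteq> \<Omega> \<and>
      superlevel_vol u x0 (-1/2) r \<le> \<mu>1 \<longrightarrow> superlevel_vol u x0 (-1 + 2 * a) (r / 4) = 0"
    using superlevel_vol_eq_0_of_small[OF assms(2,3) sp m assms(7) Wc W0 growth r(1) a(1,2)] by metis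
  obtain \<mu>2 \<epsilon>2 where 2: "0 < \<mu>2" "0 < \<epsilon>2"
    "\<And>\<epsilon> \<Omega> (u :: real ^ 'n \<Rightarrow> real) x0. 0 < \<epsilon> \<and> \<epsilon> < \<epsilon>2 \<and> \<epsilon> < 1 \<and>
      minimizer_bounded s p (\<lambda>x. W (- x)) \<epsilon> \<Omega> u \<and> \<Omega> \<in> sets lebesgue \<and> bounded \<Omega> \<and> ball x0 r \<subseteq> \<Omega> \<and>
      superlevel_vol u x0 (-1/2) r \<le> \<mu>2 \<longrightarrow> superlevel_vol u x0 (-1 + 2 * a) (r / 4) = 0"
    using superlevel_vol_eq_0_of_small[OF assms(2,3) sp m assms(7) Wc' W0' growth' r(1) a(1,2)] by metis
  define \<mu> where "\<mu> = min \<mu>1 \<mu>2"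
  have \<mu>: "0 < \<mu>" "\<mu> \<le> \<mu>1" "\<mu> \<le> \<mu>2" unfolding \<mu>_def using 1 2 by auto
  define h :: "real ^ 'n \<Rightarrow> real" where "h = (\<lambda>x. indicator E x - indicator (- E) x)"
  have "(\<lambda>k. \<integral>\<^sup>+x\<in>C. ennreal \<bar>u k x - h x\<bar> \<partial>lebesgue) \<longlonglongrightarrow> 0"
    using assms(17) C CO unfolding L1_loc_tendsto_def h_def by blast
  then have "\<forall>\<^sub>F k in sequentially. (\<integral>\<^sup>+x\<in>C. ennreal \<bar>u k x - h x\<bar> \<partial>lebesgue) < ennreal (\<mu> / 2)"
    using \<mu>(1) by (intro order_tendstoD(2)) auto
  then obtain k0 where k0: "\<And>k. k \<ge> k0 \<Longrightarrow> (\<integral>\<^sup>+x\<in>C. ennreal \<bar>u k x - h x\<bar> \<partial>lebesgue) < ennreal (\<mu> / 2)"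
    unfolding eventually_sequentially by blast
  \<comment> \<open>The conclusion concerns every index with a small parameter, not only late ones,
    and the parameters need not be monotone. Including the first \<open>k0\<close> values excludes
    those indices.\<close>
  define \<epsilon>0 where "\<epsilon>0 = Min ({\<epsilon>1, \<epsilon>2} \<union> \<epsilon> ` {..<k0})"
  have \<epsilon>0: "0 < \<epsilon>0" unfolding \<epsilon>0_def using 1 2 assms(10) by (subst Min_gr_iff) auto
  show "\<exists>\<epsilon>\<^sub>0>0. \<forall>k. \<epsilon> k < \<epsilon>\<^sub>0 \<longrightarrow> {x. \<bar>u k x\<bar> < \<Theta>} \<inter> ball 0 R \<subseteq> (\<Union>x\<in>frontier E. ball x \<delta>)"
  proof (intro exI[of _ \<epsilon>0] conjI \<epsilon>0 allI impI subsetI, rule ccontr)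
    fix k x0 assume k: "\<epsilon> k < \<epsilon>0" and x0: "x0 \<in> {x. \<bar>u k x\<bar> < \<Theta>} \<inter> ball 0 R"
      and far: "x0 \<notin> (\<Union>x\<in>frontier E. ball x \<delta>)"
    have k1: "\<epsilon> k < \<epsilon>1" "\<epsilon> k < \<epsilon>2" and kk: "k0 \<le> k"
    proof -
      show "\<epsilon> k < \<epsilon>1" "\<epsilon> k < \<epsilon>2" using k unfolding \<epsilon>0_def by (auto simp: Min_gr_iff)
      show "k0 \<le> k"
      proof (rule ccontr)
        assume "\<not> k0 \<le> k"
        then have "\<epsilon>0 \<le> \<epsilon> k" unfolding \<epsilon>0_def by (intro Min_le) auto
        then show False using k by simp
      qed
    qed
    have \<epsilon>k: "0 < \<epsilon> k" "\<epsilon> k < 1" using assms(10)[of k] by auto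
    have um: "u k \<in> borel_measurable lebesgue" by (rule Xsp_D(1)[OF assms(12)])
    have xC: "cball x0 r \<subseteq> C" using x0 by (intro cbC) auto
    then have bC: "ball x0 r \<subseteq> C" using ball_subset_cball by blast
    have cont: "continuous_on (ball x0 (r / 4)) (u k)"
    proof (rule continuous_on_subset[OF assms(14)])
      have "ball x0 (r / 4) \<subseteq> ball x0 r" using r by (intro subset_ball) auto
      then show "ball x0 (r / 4) \<subseteq> \<Omega>" using bC CO by blast
    qed
    \<comment> \<open>For unbounded \<Omega> minimality is available only on compactly contained
      subdomains, and the ball itself is one.\<close>
    obtain \<Omega>' where \<Omega>': "minimizer_bounded s p W (\<epsilon> k) \<Omega>' (u k)" "\<Omega>' \<in> sets lebesgue" "bounded \<Omega>'" "ball x0 r \<subseteq> \<Omega>'"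
    proof (cases "bounded \<Omega>")
      case True
      then show ?thesis
        using that[of \<Omega>] assms(1) assms(13)[of k] bC CO by (auto simp: minimizer_def)
    next
      case False
      have "compactly_contained (ball x0 r) \<Omega>"
        using xC CO r unfolding compactly_contained_def by auto
      then have "minimizer_bounded s p W (\<epsilon> k) (ball x0 r) (u k)"
        using assms(13)[of k] False by (simp add: minimizer_def)
      then show ?thesis using that[of "ball x0 r"] by auto
    qed
    \<comment> \<open>A connected set that misses the frontier of \<open>E\<close> lies in
      \<open>E\<close> or is disjoint from it, which fixes the sign of the limit on the
      ball.\<close>
    have "ball x0 r \<inter> frontier E = {}" using far r by (auto simp: dist_commute)
    then have "ball x0 r \<inter> E = {} \<or> ball x0 r \<subseteq> E"
      using connected_Int_frontier[of "ball x0 r" E] by auto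
    then show False
    proof
      assume E: "ball x0 r \<inter> E = {}"
      have "superlevel_vol (u k) x0 (-1/2) r \<le> \<mu>"
      proof (rule superlevel_vol_le_L1[OF um bC _ less_imp_le[OF k0[OF kk]]])
        fix x assume "x \<in> ball x0 r" "-1/2 < u k x"
        show "1/2 \<le> \<bar>u k x - h x\<bar>"
        proof -
          have "x \<notin> E" using E \<open>x \<in> ball x0 r\<close> by blast
          then show ?thesis using \<open>-1/2 < u k x\<close> by (simp add: h_def)
        qed
      qed (use \<mu> in auto)
      then have "superlevel_vol (u k) x0 (-1 + 2 * a) (r / 4) = 0"
        using 1(3)[of "\<epsilon> k" \<Omega>' "u k" x0] \<Omega>' \<epsilon>k k1 \<mu> by auto
      then have "u k x0 \<le> - \<Theta>"
        unfolding a(3) using cont r by (intro le_of_superlevel_vol_eq_0[of x0 "r / 4"]) auto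
      then show False using x0 by auto
    next
      assume E: "ball x0 r \<subseteq> E"
      have um': "(\<lambda>x. - u k x) \<in> borel_measurable lebesgue" using um by measurable
      have "superlevel_vol (\<lambda>x. - u k x) x0 (-1/2) r \<le> \<mu>"
      proof (rule superlevel_vol_le_L1[OF um' bC _ less_imp_le[OF k0[OF kk]]])
        fix x assume "x \<in> ball x0 r" "-1/2 < - u k x"
        then show "1/2 \<le> \<bar>u k x - h x\<bar>" using E by (auto simp: h_def subset_iff)
      qed (use \<mu> in auto)
      then have "superlevel_vol (\<lambda>x. - u k x) x0 (-1 + 2 * a) (r / 4) = 0"
        using 2(3)[of "\<epsilon> k" \<Omega>' "\<lambda>x. - u k x" x0] minimizer_bounded_uminus[OF \<Omega>'(1)] \<Omega>' \<epsilon>k k1 \<mu> by auto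
      then have "- u k x0 \<le> - \<Theta>"
        unfolding a(3) using cont r
        by (intro le_of_superlevel_vol_eq_0[of x0 "r / 4" "\<lambda>x. - u k x"] continuous_on_minus) auto
      then show False using x0 by auto
    qed
  qed
qed

end
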